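(* The proof system for total correctness described in the context is sound and relatively complete: for every nondeterministic quantum program $S$ and all quantum assertions $\Theta,\Psi$, the formula $\{\Theta\}S\{\Psi\}$ is derivable if and only if $\models_{\mathrm{tot}}\{\Theta\}S\{\Psi\}$. Here "relative" means that the side conditions of (Imp) and the existence of a ranking assertion in (WhileT) are semantic conditions: every true instance may be used.
   Context: Setting. Let $\mathcal{V}$ be a finite set of qubit variables. For $V\subseteq\mathcal{V}$ put $\mathcal{H}_V=\bigotimes_{q\in V}\mathcal{H}_q$ with $\mathcal{H}_q\cong\mathbb{C}^2$. For a finite-dimensional Hilbert space $\mathcal{H}$: - $\mathcal{D}(\mathcal{H})$ is the set of partial density operators, and $\sqsubseteq$ is the Löwner order. - A super-operator is a completely positive, trace-nonincreasing linear map on $\mathcal{L}(\mathcal{H})$. If $\mathcal{E}$ has Kraus operators $\{E_i\}$, its adjoint $\mathcal{E}^\dagger$ has Kraus operators $\{E_i^\dagger\}$. - Super-operators and operators on subsystems are identified with their tensor extensions by the identity. A scalar $p\in[0,1]$ is identified with $p$ times the identity. - $\mathcal{E}\preceq\mathcal{F}$ iff $\mathcal{F}=\mathcal{E}+\mathcal{G}$ for some super-operator $\mathcal{G}$. - Operations on elements extend element-wise to sets, e.g. $\mathcal{E}(\Theta)=\{\mathcal{E}(M):M\in\Theta\}$ and $A+B=\{a+b:a\in A,b\in B\}$. Programs are given by $$S::=\mathbf{skip}\mid\mathbf{abort}\mid\bar q:=0\mid\bar q\mathrel{*}=U\mid S_0;S_1\mid S_0\,\square\,S_1\mid\mathbf{if}\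 \mathcal{M}[\bar q]\ \mathbf{then}\ S_1\ \mathbf{else}\ S_0\ \mathbf{end}\mid\mathbf{while}\ \mathcal{M}[\bar q]\ \mathbf{do}\ S\ \mathbf{end},$$ where $\bar q=q_1,\dots,q_n$ are distinct variables, $U$ is a unitary on $\mathcal{H}_{\bar q}$, and $\mathcal{M}=\{P^0,P^1\}$ is a projective measurement on $\mathcal{H}_{\bar q}$. Define - $\mathcal{P}^i_{\bar q}(\rho)=P^i_{\bar q}\rho P^i_{\bar q}$, - $\mathrm{Set}^0_{\bar q}(\rho)=\sum_{i=0}^{2^n-1}|0\rangle_{\bar q}\langle i|\rho|i\rangle_{\bar q}\langle0|$, - $\mathcal{U}_{\bar q}(\rho)=U_{\bar q}\rho U_{\bar q}^\dagger$. The semantics $[\![S]\!]$ (a set of super-operators on $\mathcal{H}_{\mathcal{V}}$) is: - $[\![\mathbf{skip}]\!]=\{1\}$ and $[\![\mathbf{abort}]\!]=\{0\}$; - $[\![\bar q:=0]\!]=\{\mathrm{Set}^0_{\bar q}\}$ and $[\![\bar q\mathrel{*}=U]\!]=\{\mathcal{U}_{\bar q}\}$; - $[\![S_0;S_1]\!]=[\![S_1]\!]\circ[\![S_0]\!]$ and $[\![S_0\square S_1]\!]=[\![S_0]\!]\cup[\![S_1]\!]$; - $[\![\mathbf{if}\cdots]\!]=[\![S_0]\!]\circ\mathcal{P}^0_{\bar q}+[\![S_1]\!]\circ\mathcal{P}^1_{\bar q}$; - $[\![\mathbf{while}\ \mathcal{M}[\bar q]\ \mathbf{do}\ S\ \mathbf{end}]\!]=\{\sum_{i=0}^\infty\mathcal{P}^0_{\bar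 q}\circ\eta_i\circ\mathcal{P}^1_{\bar q}\circ\cdots\circ\eta_1\circ\mathcal{P}^1_{\bar q}:\eta\in[\![S]\!]^{\mathbb{N}}\}$, where a scheduler $\eta=(\eta_1,\eta_2,\dots)$ is a sequence in $[\![S]\!]$ and the $i=0$ term is $\mathcal{P}^0_{\bar q}$. For a scheduler $\eta$, $\eta^{\to}$ is its suffix with $\eta^{\to}_i=\eta_{i+1}$. Write $[\![S]\!](\rho)=\{\mathcal{E}(\rho):\mathcal{E}\in[\![S]\!]\}$. Assertions. - A quantum predicate is an operator $M$ on $\mathcal{H}_{\mathcal{V}}$ with $0\sqsubseteq M\sqsubseteq I$; a quantum assertion is a set of quantum predicates, and a singleton $\{M\}$ is written $M$. - $\mathrm{Exp}(\rho\models\Theta)=\inf_{M\in\Theta}\mathrm{tr}(M\rho)$. - $\models_{\mathrm{tot}}\{\Theta\}S\{\Psi\}$ means that for all $\rho\in\mathcal{D}(\mathcal{H}_{\mathcal{V}})$, $\mathrm{Exp}(\rho\models\Theta)\le\inf\{\mathrm{Exp}(\sigma\models\Psi):\sigma\in[\![S]\!](\rho)\}$. - $\Theta\le_{\mathit{inf}}\Psi$ means that for all $\rho\in\mathcal{D}(\mathcal{H}_{\mathcal{V}})$, $\inf_{M\in\Theta}\mathrm{tr}(M\rho)\le\inf_{N\in\Psi}\mathrm{tr}(N\rho)$. Ranking assertion. For a quantum assertion $\widehat\Theta$, a $\widehat\Theta$-ranking assertion for $\mathbf{while}\ \mathcal{M}[\bar q]\ \mathbf{do}\ S\ \mathbf{end}$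 is a family of quantum predicates $\{R^\eta_i:i\ge0,\eta\in[\![S]\!]^{\mathbb{N}}\}$ such that for each $\eta$: 1. $\widehat\Theta\le_{\mathit{inf}}R^\eta_0$; 2. $R^\eta_0\sqsupseteq R^\eta_1\sqsupseteq\cdots$ and $\bigwedge_iR^\eta_i=0$; 3. for all $i\ge0$, $\mathcal{P}^1_{\bar q}\circ\eta_1^\dagger(R^{\eta^\to}_i)\sqsubseteq R^\eta_{i+1}$. Proof system for total correctness: - (Skip) $\{\Theta\}\mathbf{skip}\{\Theta\}$. - (AbortT) $\{0\}\mathbf{abort}\{0\}$. - (Init) $\{\sum_{i=0}^{2^n-1}|i\rangle_{\bar q}\langle0|\Theta|0\rangle_{\bar q}\langle i|\}\ \bar q:=0\ \{\Theta\}$. - (Unit) $\{U^\dagger_{\bar q}\Theta U_{\bar q}\}\ \bar q\mathrel{*}=U\ \{\Theta\}$. - (Seq) from $\{\Theta\}S_0\{\Theta'\}$ and $\{\Theta'\}S_1\{\Psi\}$ infer $\{\Theta\}S_0;S_1\{\Psi\}$. - (NDet) from $\{\Theta\}S_0\{\Psi\}$ and $\{\Theta\}S_1\{\Psi\}$ infer $\{\Theta\}S_0\square S_1\{\Psi\}$. - (Meas) from $\{\Theta_1\}S_1\{\Psi\}$ and $\{\Theta_0\}S_0\{\Psi\}$ infer $\{\mathcal{P}^0_{\bar q}(\Theta_0)+\mathcal{P}^1_{\bar q}(\Theta_1)\}\ \mathbf{if}\ \mathcal{M}[\bar q]\ \mathbf{then}\ S_1\ \mathbf{else}\ S_0\ \mathbf{end}\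 \{\Psi\}$. - (WhileT) from $\{\Theta\}S\{\mathcal{P}^0_{\bar q}(\Psi)+\mathcal{P}^1_{\bar q}(\Theta)\}$ and the existence of a $(\mathcal{P}^0_{\bar q}(\Psi)+\mathcal{P}^1_{\bar q}(\Theta))$-ranking assertion for the loop, infer $\{\mathcal{P}^0_{\bar q}(\Psi)+\mathcal{P}^1_{\bar q}(\Theta)\}\ \mathbf{while}\ \mathcal{M}[\bar q]\ \mathbf{do}\ S\ \mathbf{end}\ \{\Psi\}$. - (Imp) from $\Theta\le_{\mathit{inf}}\Theta'$, $\{\Theta'\}S\{\Psi'\}$ and $\Psi'\le_{\mathit{inf}}\Psi$ infer $\{\Theta\}S\{\Psi\}$. - (Union) from $\{\Theta_i\}S\{\Psi_i\}$ for all $i\in I$ infer $\{\bigcup_i\Theta_i\}S\{\bigcup_i\Psi_i\}$. *)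

theory Defs
  imports "HOL-Analysis.Analysis"
begin

section \<open>Operators on the global state space\<close>

text \<open>
  The finite set of qubit variables is the universe of a finite type \<open>'q\<close>. The computational
  basis of the global Hilbert space consists of the assignments \<open>'q \<Rightarrow> bool\<close>, and operators are
  matrices indexed by this basis.
\<close>

type_synonym 'q oper = "complex ^ ('q \<Rightarrow> bool) ^ ('q \<Rightarrow> bool)"

type_synonym 'q superop = "'q oper \<Rightarrow> 'q oper"

definition dagger :: "'q::finite oper \<Rightarrow> 'q oper" where
  "dagger A = (\<chi> s t. cnj (A $ t $ s))"

definition psd :: "'q::finite oper \<Rightarrow> bool" where
  "psd A \<longleftrightarrow> dagger A = A \<and> (\<forall>v. 0 \<le> Re (\<Sum>s\<in>UNIV. cnj (v $ s) * (A *v v) $ s))"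

definition lowner_le :: "'q::finite oper \<Rightarrow> 'q oper \<Rightarrow> bool"  (infix "\<sqsubseteq>\<^sub>L" 50) where
  "A \<sqsubseteq>\<^sub>L B \<longleftrightarrow> psd (B - A)"

definition partial_density :: "'q::finite oper \<Rightarrow> bool" where
  "partial_density \<rho> \<longleftrightarrow> psd \<rho> \<and> Re (trace \<rho>) \<le> 1"

definition kraus_map :: "'q::finite oper list \<Rightarrow> 'q superop" where
  "kraus_map Es = (\<lambda>\<rho>. \<Sum>E\<leftarrow>Es. E ** \<rho> ** dagger E)"

text \<open>
  The adjoint is defined for maps that possess a finite Kraus representation; it does not depend
  on the chosen representation, see \<open>superop_adjoint_kraus_map\<close> below.
\<close>

definition superop_adjoint :: "'q::finite superop \<Rightarrow> 'q superop" where
  "superop_adjoint \<E> = (THE \<F>. \<exists>Es. \<E> = kraus_map Es \<and> \<F> = kraus_map (map dagger Es))"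

lemma dagger_dagger [simp]: "dagger (dagger A) = A"
  by (simp add: dagger_def vec_eq_iff)

lemma oper_mult_add_left: "(A + B) ** C = A ** C + B ** (C :: 'q::finite oper)"
  by (simp add: vec_eq_iff matrix_matrix_mult_def sum.distrib distrib_right)

lemma trace_kraus_map_dual:
  "trace (kraus_map (map dagger Es) M ** \<rho>) = trace (M ** kraus_map Es \<rho>)"
proof (induction Es)
  case Nil
  then show ?case by (simp add: kraus_map_def)
next
  case (Cons E Es)
  have "trace (dagger E ** M ** E ** \<rho>) = trace (M ** (E ** \<rho> ** dagger E))"
    by (metis matrix_mul_assoc trace_mul_sym)
  with Cons show ?case
    by (simp add: kraus_map_def oper_mult_add_left matrix_add_ldistrib trace_add)
qed

lemma trace_dual_unique:
  fixes A B :: "'q::finite oper"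
  assumes "\<And>\<rho>. trace (A ** \<rho>) = trace (B ** \<rho>)"
  shows "A = B"
proof -
  have *: "trace (C ** (\<chi> i j. if i = t \<and> j = s then 1 else 0)) = C $ s $ t"
    for C :: "'q oper" and s t
  proof -
    have "trace (C ** (\<chi> i j. if i = t \<and> j = s then 1 else 0)) =
          (\<Sum>i\<in>UNIV. \<Sum>k\<in>UNIV. if k = t then (if i = s then C $ i $ k else 0) else 0)"
      unfolding trace_def matrix_matrix_mult_def vec_lambda_beta
      by (intro sum.cong refl) auto
    then show ?thesis by simp
  qed
  show ?thesis
    using assms * by (metis vec_eq_iff)
qed

lemma superop_adjoint_kraus_map: "superop_adjoint (kraus_map Es) = kraus_map (map dagger Es)"
  unfolding superop_adjoint_def
proof (rule the_equality)
  fix \<F> :: "'a superop"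
  assume "\<exists>Fs. kraus_map Es = kraus_map Fs \<and> \<F> = kraus_map (map dagger Fs)"
  then obtain Fs where Fs: "kraus_map Es = kraus_map Fs" "\<F> = kraus_map (map dagger Fs)"
    by blast
  show "\<F> = kraus_map (map dagger Es)"
    unfolding Fs(2) by (rule ext, rule trace_dual_unique) (simp add: trace_kraus_map_dual Fs(1))
qed blast


section \<open>Operators on quantum registers\<close>

text \<open>
  An operator on an \<open>n\<close>-qubit register is given by its matrix entries; rows and columns are
  bit strings of length \<open>n\<close>, the \<open>k\<close>-th bit belonging to the \<open>k\<close>-th variable of the register.
  Entries at lists of any other length are irrelevant.
\<close>

type_synonym regop = "bool list \<Rightarrow> bool list \<Rightarrow> complex"

definition bits :: "nat \<Rightarrow> bool list set" where
  "bits n = {x. length x = n}"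

definition reg_id :: regop where
  "reg_id x y = (if x = y then 1 else 0)"

definition reg_zero :: regop where
  "reg_zero x y = 0"

definition reg_add :: "regop \<Rightarrow> regop \<Rightarrow> regop" where
  "reg_add A B x y = A x y + B x y"

definition reg_mult :: "nat \<Rightarrow> regop \<Rightarrow> regop \<Rightarrow> regop" where
  "reg_mult n A B x z = (\<Sum>y\<in>bits n. A x y * B y z)"

definition reg_dagger :: "regop \<Rightarrow> regop" where
  "reg_dagger A x y = cnj (A y x)"

definition reg_eq :: "nat \<Rightarrow> regop \<Rightarrow> regop \<Rightarrow> bool" where
  "reg_eq n A B \<longleftrightarrow> (\<forall>x\<in>bits n. \<forall>y\<in>bits n. A x y = B x y)"

definition reg_unitary :: "nat \<Rightarrow> regop \<Rightarrow> bool" where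
  "reg_unitary n U \<longleftrightarrow>
     reg_eq n (reg_mult n (reg_dagger U) U) reg_id \<and> reg_eq n (reg_mult n U (reg_dagger U)) reg_id"

definition reg_projector :: "nat \<Rightarrow> regop \<Rightarrow> bool" where
  "reg_projector n P \<longleftrightarrow> reg_eq n (reg_dagger P) P \<and> reg_eq n (reg_mult n P P) P"

definition reg_proj_meas :: "nat \<Rightarrow> regop \<Rightarrow> regop \<Rightarrow> bool" where
  "reg_proj_meas n P0 P1 \<longleftrightarrow>
     reg_projector n P0 \<and> reg_projector n P1 \<and>
     reg_eq n (reg_mult n P0 P1) reg_zero \<and> reg_eq n (reg_add P0 P1) reg_id"

definition ketbra :: "bool list \<Rightarrow> bool list \<Rightarrow> regop" where
  "ketbra a b x y = (if x = a \<and> y = b then 1 else 0)"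

text \<open>
  The tensor extension of an operator on the register \<open>qs\<close> by the identity on the remaining
  variables.
\<close>

definition lift_op :: "'q list \<Rightarrow> regop \<Rightarrow> 'q::finite oper" where
  "lift_op qs A =
     (\<chi> s t. if (\<forall>q. q \<notin> set qs \<longrightarrow> s q = t q) then A (map s qs) (map t qs) else 0)"

definition conj_by :: "'q::finite oper \<Rightarrow> 'q superop" where
  "conj_by A \<rho> = A ** \<rho> ** dagger A"

definition proj_so :: "'q list \<Rightarrow> regop \<Rightarrow> 'q::finite superop" where
  "proj_so qs P \<rho> = lift_op qs P ** \<rho> ** lift_op qs P"

definition set0_so :: "'q list \<Rightarrow> 'q::finite superop" where
  "set0_so qs \<rho> = (\<Sum>i\<in>bits (length qs).
     lift_op qs (ketbra (replicate (length qs) False) i) ** \<rho> **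
     lift_op qs (ketbra i (replicate (length qs) False)))"

definition init_pre :: "'q list \<Rightarrow> 'q::finite superop" where
  "init_pre qs M = (\<Sum>i\<in>bits (length qs).
     lift_op qs (ketbra i (replicate (length qs) False)) ** M **
     lift_op qs (ketbra (replicate (length qs) False) i))"


section \<open>Programs and their semantics\<close>

text \<open>
  \<open>Cond qs P0 P1 S1 S0\<close> is \<open>if M[qs] then S1 else S0 end\<close>, and \<open>While qs P0 P1 S\<close> is
  \<open>while M[qs] do S end\<close>, with \<open>M = {P0, P1}\<close>. Distinctness of the variables, unitarity, and the
  measurement conditions are imposed by \<open>wf_prog\<close>.
\<close>

datatype 'q prog =
    Skip
  | Abort
  | Init "'q list"
  | Unit "'q list" regop
  | Seq "'q prog" "'q prog"
  | NDet "'q prog" "'q prog"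
  | Cond "'q list" regop regop "'q prog" "'q prog"
  | While "'q list" regop regop "'q prog"

primrec wf_prog :: "'q prog \<Rightarrow> bool" where
  "wf_prog Skip \<longleftrightarrow> True"
| "wf_prog Abort \<longleftrightarrow> True"
| "wf_prog (Init qs) \<longleftrightarrow> distinct qs"
| "wf_prog (Unit qs U) \<longleftrightarrow> distinct qs \<and> reg_unitary (length qs) U"
| "wf_prog (Seq S0 S1) \<longleftrightarrow> wf_prog S0 \<and> wf_prog S1"
| "wf_prog (NDet S0 S1) \<longleftrightarrow> wf_prog S0 \<and> wf_prog S1"
| "wf_prog (Cond qs P0 P1 S1 S0) \<longleftrightarrow>
     distinct qs \<and> reg_proj_meas (length qs) P0 P1 \<and> wf_prog S1 \<and> wf_prog S0"
| "wf_prog (While qs P0 P1 S) \<longleftrightarrow>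
     distinct qs \<and> reg_proj_meas (length qs) P0 P1 \<and> wf_prog S"

text \<open>
  Schedulers are functions on \<open>nat\<close> starting at index 0, so \<open>\<eta> 0\<close> is the first element of the
  sequence. \<open>loop_iter E1 \<eta> i\<close> is the result of \<open>i\<close> rounds, each consisting of \<open>E1\<close> followed by
  the next element of \<open>\<eta>\<close>.
\<close>

primrec loop_iter :: "'q::finite superop \<Rightarrow> (nat \<Rightarrow> 'q superop) \<Rightarrow> nat \<Rightarrow> 'q superop" where
  "loop_iter E1 \<eta> 0 = id"
| "loop_iter E1 \<eta> (Suc i) = \<eta> i \<circ> E1 \<circ> loop_iter E1 \<eta> i"

primrec sem :: "'q::finite prog \<Rightarrow> 'q superop set" where
  "sem Skip = {id}"
| "sem Abort = {\<lambda>_. 0}"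
| "sem (Init qs) = {set0_so qs}"
| "sem (Unit qs U) = {conj_by (lift_op qs U)}"
| "sem (Seq S0 S1) = {F \<circ> E | E F. E \<in> sem S0 \<and> F \<in> sem S1}"
| "sem (NDet S0 S1) = sem S0 \<union> sem S1"
| "sem (Cond qs P0 P1 S1 S0) =
     {\<lambda>\<rho>. E0 (proj_so qs P0 \<rho>) + E1 (proj_so qs P1 \<rho>) | E0 E1. E0 \<in> sem S0 \<and> E1 \<in> sem S1}"
| "sem (While qs P0 P1 S) =
     {\<lambda>\<rho>. \<Sum>i. proj_so qs P0 (loop_iter (proj_so qs P1) \<eta> i \<rho>) | \<eta>. \<forall>i. \<eta> i \<in> sem S}"


section \<open>Assertions and total correctness\<close>

definition quantum_predicate :: "'q::finite oper \<Rightarrow> bool" where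
  "quantum_predicate M \<longleftrightarrow> 0 \<sqsubseteq>\<^sub>L M \<and> M \<sqsubseteq>\<^sub>L mat 1"

definition assertion :: "'q::finite oper set \<Rightarrow> bool" where
  "assertion \<Theta> \<longleftrightarrow> (\<forall>M\<in>\<Theta>. quantum_predicate M)"

text \<open>
  The empty set is a quantum assertion; infima are taken in the extended reals so that the infimum
  over the empty set is \<open>\<infinity>\<close>.
\<close>

definition Exp :: "'q::finite oper \<Rightarrow> 'q oper set \<Rightarrow> ereal" where
  "Exp \<rho> \<Theta> = (INF M\<in>\<Theta>. ereal (Re (trace (M ** \<rho>))))"

definition le_inf :: "'q::finite oper set \<Rightarrow> 'q oper set \<Rightarrow> bool" where
  "le_inf \<Theta> \<Psi> \<longleftrightarrow> (\<forall>\<rho>. partial_density \<rho> \<longrightarrow> Exp \<rho> \<Theta> \<le> Exp \<rho> \<Psi>)"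

definition valid_tot :: "'q::finite oper set \<Rightarrow> 'q prog \<Rightarrow> 'q oper set \<Rightarrow> bool" where
  "valid_tot \<Theta> S \<Psi> \<longleftrightarrow>
     (\<forall>\<rho>. partial_density \<rho> \<longrightarrow> Exp \<rho> \<Theta> \<le> (INF \<sigma>\<in>(\<lambda>\<E>. \<E> \<rho>) ` sem S. Exp \<sigma> \<Psi>))"


section \<open>The proof system\<close>

definition meas_pre :: "'q list \<Rightarrow> regop \<Rightarrow> regop \<Rightarrow> 'q::finite oper set \<Rightarrow> 'q oper set \<Rightarrow> 'q oper set"
  where "meas_pre qs P0 P1 \<Theta>0 \<Theta>1 =
     {proj_so qs P0 M0 + proj_so qs P1 M1 | M0 M1. M0 \<in> \<Theta>0 \<and> M1 \<in> \<Theta>1}"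

text \<open>
  The meet of the family \<open>R \<eta> i\<close> (over \<open>i\<close>) being 0 is stated as 0 being the greatest lower
  bound of the family in the Loewner order. Only the values of \<open>R\<close> at schedulers in the semantics
  of the loop body matter.
\<close>

definition ranking_assertion ::
  "'q::finite oper set \<Rightarrow> 'q list \<Rightarrow> regop \<Rightarrow> 'q prog \<Rightarrow> ((nat \<Rightarrow> 'q superop) \<Rightarrow> nat \<Rightarrow> 'q oper) \<Rightarrow> bool"
  where "ranking_assertion \<Theta>' qs P1 S R \<longleftrightarrow>
    (\<forall>\<eta>. (\<forall>i. \<eta> i \<in> sem S) \<longrightarrow>
       (\<forall>i. quantum_predicate (R \<eta> i)) \<and>
       le_inf \<Theta>' {R \<eta> 0} \<and>
       (\<forall>i. R \<eta> (Suc i) \<sqsubseteq>\<^sub>L R \<eta> i) \<and>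
       (\<forall>i. 0 \<sqsubseteq>\<^sub>L R \<eta> i) \<and> (\<forall>A. (\<forall>i. A \<sqsubseteq>\<^sub>L R \<eta> i) \<longrightarrow> A \<sqsubseteq>\<^sub>L 0) \<and>
       (\<forall>i. proj_so qs P1 (superop_adjoint (\<eta> 0) (R (\<lambda>k. \<eta> (Suc k)) i)) \<sqsubseteq>\<^sub>L R \<eta> (Suc i)))"

text \<open>
  In rule \<open>Union\<close>, the family of pairs of assertions is indexed by itself: every family
  with an arbitrary index set gives rise to the set \<open>C\<close> of its members, with the same unions.
\<close>

inductive derivable :: "'q::finite oper set \<Rightarrow> 'q prog \<Rightarrow> 'q oper set \<Rightarrow> bool" where
  Skip: "assertion \<Theta> \<Longrightarrow> derivable \<Theta> Skip \<Theta>"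
| AbortT: "derivable {0} Abort {0}"
| Init: "assertion \<Theta> \<Longrightarrow> derivable (init_pre qs ` \<Theta>) (Init qs) \<Theta>"
| Unit: "assertion \<Theta> \<Longrightarrow>
    derivable ((\<lambda>M. dagger (lift_op qs U) ** M ** lift_op qs U) ` \<Theta>) (Unit qs U) \<Theta>"
| Seq: "derivable \<Theta> S0 \<Theta>' \<Longrightarrow> derivable \<Theta>' S1 \<Psi> \<Longrightarrow> derivable \<Theta> (Seq S0 S1) \<Psi>"
| NDet: "derivable \<Theta> S0 \<Psi> \<Longrightarrow> derivable \<Theta> S1 \<Psi> \<Longrightarrow> derivable \<Theta> (NDet S0 S1) \<Psi>"
| Meas: "derivable \<Theta>1 S1 \<Psi> \<Longrightarrow> derivable \<Theta>0 S0 \<Psi> \<Longrightarrow>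
    derivable (meas_pre qs P0 P1 \<Theta>0 \<Theta>1) (Cond qs P0 P1 S1 S0) \<Psi>"
| WhileT: "assertion \<Psi> \<Longrightarrow>
    derivable \<Theta> S (meas_pre qs P0 P1 \<Psi> \<Theta>) \<Longrightarrow>
    \<exists>R. ranking_assertion (meas_pre qs P0 P1 \<Psi> \<Theta>) qs P1 S R \<Longrightarrow>
    derivable (meas_pre qs P0 P1 \<Psi> \<Theta>) (While qs P0 P1 S) \<Psi>"
| Imp: "assertion \<Theta> \<Longrightarrow> assertion \<Psi> \<Longrightarrow> le_inf \<Theta> \<Theta>' \<Longrightarrow> derivable \<Theta>' S \<Psi>' \<Longrightarrow> le_inf \<Psi>' \<Psi> \<Longrightarrow>
    derivable \<Theta> S \<Psi>"
| Union: "(\<And>\<Theta> \<Psi>. (\<Theta>, \<Psi>) \<in> C \<Longrightarrow> derivable \<Theta> S \<Psi>) \<Longrightarrow>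
    derivable (\<Union>(\<Theta>, \<Psi>)\<in>C. \<Theta>) S (\<Union>(\<Theta>, \<Psi>)\<in>C. \<Psi>)"

end

theory Submission
  imports Defs
begin

text \<open>
  Completeness rests on the set of adjoints \<open>wp S \<Psi> = {\<E>\<^sup>\<dagger>(N) | \<E> \<in> \<lbrakk>S\<rbrakk>, N \<in> \<Psi>}\<close>: validity of \<open>{\<Theta>} S {\<Psi>}\<close> is the same as
  \<open>\<Theta> \<le>\<^sub>i\<^sub>n\<^sub>f wp S \<Psi>\<close>, so by (Imp) it suffices to derive \<open>{wp S \<Psi>} S {\<Psi>}\<close>. By (Union) the postcondition may
  be taken to be a singleton \<open>{N}\<close>, and then everything is an equality: the two branches of a
  conditional share the same \<open>N\<close>, and the loop precondition is a fixed point of the invariant map. The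
  ranking predicate \<open>R\<^sub>i\<close> is the adjoint, applied to \<open>N\<close>, of the tail of the loop series starting at \<open>i\<close>.

  Adjoints are available only for maps with a finite Kraus representation, so the loop series must
  be shown to have one; this follows from Choi's theorem, because positivity of the Choi matrix
  survives limits.

  In the soundness proof of (WhileT), \<open>n\<close> unfoldings bound the expectation of the invariant by a partial
  sum of the loop series plus \<open>tr(R\<^sub>n \<rho>)\<close>. In finite dimension a decreasing sequence of
  positive operators converges, and its limit is a lower bound, so the last term tends to 0.
\<close>

section \<open>Positive kernels\<close>

text \<open>Kernels live on an arbitrary finite index type because two index types occur: basis
  assignments for operators, and pairs of them for Choi matrices.\<close>

definition quad_form :: "('n::finite \<Rightarrow> 'n \<Rightarrow> complex) \<Rightarrow> ('n \<Rightarrow> complex) \<Rightarrow> real" where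
  "quad_form A x = Re (\<Sum>i\<in>UNIV. \<Sum>j\<in>UNIV. cnj (x i) * A i j * x j)"

definition pos_kernel :: "('n::finite \<Rightarrow> 'n \<Rightarrow> complex) \<Rightarrow> bool" where
  "pos_kernel A \<longleftrightarrow> (\<forall>i j. cnj (A j i) = A i j) \<and> (\<forall>x. 0 \<le> quad_form A x)"

lemma Re_mult_cnj: "Re (z * cnj z) = (cmod z)\<^sup>2"
  by (simp only: complex_norm_square[symmetric] Re_complex_of_real)

text \<open>Changing one coordinate of the argument gives a quadratic polynomial in the change
  \<open>c\<close>. Suitable choices of \<open>x\<close> and \<open>c\<close> yield the diagonal,
  zero-row and Schur facts that follow.\<close>

lemma quad_form_add_unit:
  assumes "\<And>i j. cnj (A j i) = A i j"
  shows "quad_form A (\<lambda>i. x i + (if i = a then c else 0)) =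
    quad_form A x + 2 * Re (cnj c * (\<Sum>j\<in>UNIV. A a j * x j)) + (cmod c)\<^sup>2 * Re (A a a)"
proof -
  define e where "e = (\<lambda>i. if i = a then c else 0)"
  have e_left: "(\<Sum>i\<in>UNIV. cnj (e i) * f i) = cnj c * f a" for f
    by (simp add: e_def if_distrib[of cnj] if_distrib[of "\<lambda>y. y * _"] cong: if_cong)
  have e_right: "(\<Sum>i\<in>UNIV. f i * e i) = f a * c" for f
    by (simp add: e_def if_distrib[of "\<lambda>y. _ * y"] cong: if_cong)
  have 1: "(\<Sum>i\<in>UNIV. \<Sum>j\<in>UNIV. cnj (e i) * A i j * x j) = cnj c * (\<Sum>j\<in>UNIV. A a j * x j)"
    by (simp add: mult.assoc e_left flip: sum_distrib_left)
  have 2: "(\<Sum>i\<in>UNIV. \<Sum>j\<in>UNIV. cnj (x i) * A i j * e j) = cnj (cnj c * (\<Sum>j\<in>UNIV. A a j * x j))"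
    unfolding e_right by (simp add: assms sum_distrib_right mult.commute[of c]) (simp add: mult.commute)
  have "(\<Sum>i\<in>UNIV. \<Sum>j\<in>UNIV. cnj (e i) * A i j * e j) = cnj c * A a a * c"
    unfolding e_right by (simp add: e_left mult.assoc)
  also have "\<dots> = of_real ((cmod c)\<^sup>2) * A a a"
    by (simp add: complex_norm_square mult_ac del: of_real_power)
  finally have 3: "(\<Sum>i\<in>UNIV. \<Sum>j\<in>UNIV. cnj (e i) * A i j * e j) = of_real ((cmod c)\<^sup>2) * A a a" .
  have "(\<Sum>i\<in>UNIV. \<Sum>j\<in>UNIV. cnj (x i + e i) * A i j * (x j + e j)) =
    (\<Sum>i\<in>UNIV. \<Sum>j\<in>UNIV. cnj (x i) * A i j * x j) + (\<Sum>i\<in>UNIV. \<Sum>j\<in>UNIV. cnj (e i) * A i j * x j) +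
    (\<Sum>i\<in>UNIV. \<Sum>j\<in>UNIV. cnj (x i) * A i j * e j) + (\<Sum>i\<in>UNIV. \<Sum>j\<in>UNIV. cnj (e i) * A i j * e j)"
    by (simp add: algebra_simps sum.distrib)
  then show ?thesis
    unfolding quad_form_def 1 2 3 unfolding e_def
    by (simp del: Re_sum Im_sum complex_cnj_mult cnj_sum times_complex.sel of_real_power
        add: times_complex.sel(1)[of "complex_of_real _"])
qed

lemma pos_kernel_herm: "pos_kernel A \<Longrightarrow> cnj (A j i) = A i j"
  by (simp add: pos_kernel_def)

lemma pos_kernel_diag:
  assumes "pos_kernel A"
  shows "A a a = of_real (Re (A a a))" "0 \<le> Re (A a a)"
proof -
  have "Im (A a a) = 0"
    using pos_kernel_herm[OF assms, of a a] by (simp add: complex_eq_iff)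
  then show "A a a = of_real (Re (A a a))" by (simp add: complex_eq_iff)
  have "0 \<le> quad_form A (\<lambda>i. 0 + (if i = a then 1 else 0))"
    using assms unfolding pos_kernel_def by blast
  then show "0 \<le> Re (A a a)"
    using assms by (subst (asm) quad_form_add_unit) (simp_all add: pos_kernel_def quad_form_def)
qed

text \<open>With \<open>A a a = 0\<close> the quadratic term in \<open>c\<close> vanishes, so a
  nonzero \<open>A a b\<close> would drive the form below zero in the direction
  \<open>- A a b\<close>.\<close>

lemma pos_kernel_diag_eq_0:
  assumes "pos_kernel A" "A a a = 0"
  shows "A a b = 0"
proof (rule ccontr)
  assume nz: "A a b \<noteq> 0"
  define x :: "'a \<Rightarrow> complex" where "x = (\<lambda>j. if j = b then 1 else 0)"
  \<comment> \<open>Chosen so that the form takes the value -1.\<close>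
  define t where "t = (quad_form A x + 1) / (2 * (cmod (A a b))\<^sup>2)"
  define c where "c = - of_real t * A a b"
  have "(\<Sum>j\<in>UNIV. A a j * x j) = A a b"
    by (simp add: x_def if_distrib[of "\<lambda>y. _ * y"] cong: if_cong)
  then have "quad_form A (\<lambda>i. x i + (if i = a then c else 0)) = quad_form A x + 2 * Re (cnj c * A a b)"
    using pos_kernel_herm[OF assms(1)] by (simp add: quad_form_add_unit assms(2))
  also have "Re (cnj c * A a b) = - t * Re (A a b * cnj (A a b))"
    by (simp add: c_def algebra_simps)
  also have "quad_form A x + 2 * (- t * Re (A a b * cnj (A a b))) = quad_form A x - t * (2 * (cmod (A a b))\<^sup>2)"
    unfolding Re_mult_cnj by simp
  also have "\<dots> < 0"
    using nz by (simp add: t_def)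
  finally show False
    using assms(1) by (auto simp: pos_kernel_def not_less[symmetric])
qed

text \<open>Completing the square: the form of the Schur complement at \<open>x\<close> is the
  minimum of the form of \<open>A\<close> over all changes of the coordinate \<open>a\<close> of
  \<open>x\<close>, attained at the change \<open>- b / r\<close>.\<close>

lemma pos_kernel_schur:
  assumes "pos_kernel A" "A a a \<noteq> 0"
  shows "pos_kernel (\<lambda>i j. A i j - A i a * A a j / A a a)"
  unfolding pos_kernel_def
proof (intro conjI allI)
  have herm: "cnj (A j i) = A i j" for i j
    by (rule pos_kernel_herm[OF assms(1)])
  then show "cnj (A j i - A j a * A a i / A a a) = A i j - A i a * A a j / A a a" for i j
    by (simp add: mult.commute)
  fix x
  define r where "r = Re (A a a)"
  have Aaa: "A a a = of_real r"
    unfolding r_def by (rule pos_kernel_diag[OF assms(1)])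
  then have r: "r \<noteq> 0"
    using assms(2) by auto
  define b where "b = (\<Sum>j\<in>UNIV. A a j * x j)"
  have b': "(\<Sum>i\<in>UNIV. cnj (x i) * A i a) = cnj b"
    by (simp add: b_def herm mult.commute)
  have "(\<Sum>i\<in>UNIV. \<Sum>j\<in>UNIV. cnj (x i) * (A i j - A i a * A a j / A a a) * x j) =
    (\<Sum>i\<in>UNIV. \<Sum>j\<in>UNIV. cnj (x i) * A i j * x j) - (\<Sum>i\<in>UNIV. \<Sum>j\<in>UNIV. (cnj (x i) * A i a) * (A a j * x j)) / A a a"
    by (simp add: algebra_simps sum_subtractf sum_divide_distrib)
  also have "(\<Sum>i\<in>UNIV. \<Sum>j\<in>UNIV. (cnj (x i) * A i a) * (A a j * x j)) = cnj b * b"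
    by (simp add: b' b_def flip: sum_distrib_left sum_distrib_right)
  finally have "quad_form (\<lambda>i j. A i j - A i a * A a j / A a a) x = quad_form A x - (cmod b)\<^sup>2 / r"
    by (simp only: quad_form_def Aaa minus_complex.sel Re_divide_of_real mult.commute[of "cnj b"] Re_mult_cnj)
  moreover have "Re (cnj (- b / of_real r) * b) = - (cmod b)\<^sup>2 / r"
  proof -
    have "cnj (- b / of_real r) * b = - (b * cnj b) / of_real r"
      by simp
    then show ?thesis
      by (simp only: Re_divide_of_real uminus_complex.sel Re_mult_cnj)
  qed
  then have "quad_form A (\<lambda>i. x i + (if i = a then - b / of_real r else 0)) = quad_form A x - (cmod b)\<^sup>2 / r"
    using r unfolding quad_form_add_unit[OF herm] b_def[symmetric] r_def[symmetric]
    by (simp add: norm_divide power2_eq_square)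
  moreover have "0 \<le> quad_form A (\<lambda>i. x i + (if i = a then - b / of_real r else 0))"
    using assms(1) by (simp add: pos_kernel_def)
  ultimately show "0 \<le> quad_form (\<lambda>i j. A i j - A i a * A a j / A a a) x"
    by linarith
qed

text \<open>Subtracting the rank-one kernel of \<open>pos_kernel_schur\<close> clears one diagonal entry and keeps the zero
  ones, since a positive kernel vanishes on the row of a zero diagonal entry.\<close>

lemma pos_kernel_rank_one_sum:
  assumes "pos_kernel A"
  shows "\<exists>vs. \<forall>i j. A i j = (\<Sum>v\<leftarrow>vs. v i * cnj (v j))"
  using assms
proof (induction "card {i. A i i \<noteq> 0}" arbitrary: A rule: less_induct)
  case less
  show ?case
  proof (cases "\<exists>a. A a a \<noteq> 0")
    case False
    then have "A i j = 0" for i j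
      using pos_kernel_diag_eq_0[OF less.prems, of i j] by blast
    then have "\<forall>i j. A i j = (\<Sum>v\<leftarrow>[]. v i * cnj (v j))"
      by simp
    then show ?thesis by (rule exI)
  next
    case True
    then obtain a where a: "A a a \<noteq> 0" by blast
    define B where "B = (\<lambda>i j. A i j - A i a * A a j / A a a)"
    have "B i i = 0" if "A i i = 0" for i
      using that pos_kernel_diag_eq_0[OF less.prems that, of a] by (simp add: B_def)
    moreover have "B a a = 0"
      using a by (simp add: B_def)
    ultimately have "{i. B i i \<noteq> 0} \<subset> {i. A i i \<noteq> 0}"
      using a by blast
    then have "card {i. B i i \<noteq> 0} < card {i. A i i \<noteq> 0}"
      by (intro psubset_card_mono) auto
    moreover have "pos_kernel B"
      unfolding B_def using less.prems a by (rule pos_kernel_schur)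
    ultimately obtain vs where vs: "\<And>i j. B i j = (\<Sum>v\<leftarrow>vs. v i * cnj (v j))"
      using less.hyps by blast
    \<comment> \<open>Column \<open>a\<close>, scaled so that \<open>w i * cnj (w j)\<close> is the
      rank-one term subtracted in \<open>B\<close>.\<close>
    define w where "w i = A i a / of_real (sqrt (Re (A a a)))" for i
    have "complex_of_real (sqrt (Re (A a a))) * of_real (sqrt (Re (A a a))) = of_real (Re (A a a))"
      using pos_kernel_diag(2)[OF less.prems, of a] by (simp flip: of_real_mult)
    also have "\<dots> = A a a"
      by (rule pos_kernel_diag(1)[OF less.prems, symmetric])
    finally have sqrt: "complex_of_real (sqrt (Re (A a a))) * of_real (sqrt (Re (A a a))) = A a a" .
    have "w i * cnj (w j) = A i a * A a j / A a a" for i j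
    proof -
      have "cnj (w j) = A a j / of_real (sqrt (Re (A a a)))"
        unfolding w_def complex_cnj_divide complex_cnj_complex_of_real pos_kernel_herm[OF less.prems] ..
      then show ?thesis
        unfolding w_def by (simp only: times_divide_times_eq sqrt)
    qed
    then have "\<forall>i j. A i j = (\<Sum>v\<leftarrow>w # vs. v i * cnj (v j))"
      unfolding list.map sum_list.Cons vs[symmetric] B_def by simp
    then show ?thesis by (rule exI)
  qed
qed

lemma pos_kernel_rank_one_sumI: "pos_kernel (\<lambda>i j. \<Sum>v\<leftarrow>vs. v i * cnj (v j))"
proof (induction vs)
  case (Cons w vs)
  have "(\<Sum>i\<in>UNIV. \<Sum>j\<in>UNIV. cnj (x i) * (w i * cnj (w j) + f i j) * x j) =
    (\<Sum>i\<in>UNIV. cnj (x i) * w i) * cnj (\<Sum>i\<in>UNIV. cnj (x i) * w i) + (\<Sum>i\<in>UNIV. \<Sum>j\<in>UNIV. cnj (x i) * f i j * x j)"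
    for x f by (simp add: sum_product algebra_simps sum.distrib)
  then have "quad_form (\<lambda>i j. w i * cnj (w j) + f i j) x = (cmod (\<Sum>i\<in>UNIV. cnj (x i) * w i))\<^sup>2 + quad_form f x" for f x
    unfolding quad_form_def by (simp only: plus_complex.sel Re_mult_cnj)
  with Cons show ?case
    by (simp add: pos_kernel_def)
qed (simp add: pos_kernel_def quad_form_def)

text \<open>On a rank-one sum this is the arithmetic-geometric mean inequality, term by term. It
  lets convergence of traces control convergence of all entries.\<close>

lemma pos_kernel_norm_le:
  assumes "pos_kernel A"
  shows "norm (A i j) \<le> (\<Sum>k\<in>UNIV. Re (A k k))"
proof -
  obtain vs where vs: "\<And>i j. A i j = (\<Sum>v\<leftarrow>vs. v i * cnj (v j))"
    using pos_kernel_rank_one_sum[OF assms] by blast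
  have diag: "Re (A k k) = (\<Sum>v\<leftarrow>vs. (cmod (v k))\<^sup>2)" for k
    unfolding vs by (induction vs) (simp_all only: list.map sum_list.Nil sum_list.Cons plus_complex.sel Re_mult_cnj zero_complex.sel)
  have "norm (A i j) \<le> (\<Sum>v\<leftarrow>vs. cmod (v i) * cmod (v j))"
    unfolding vs by (induction vs) (auto intro!: norm_triangle_le simp: norm_mult)
  also have "\<dots> \<le> (\<Sum>v\<leftarrow>vs. ((cmod (v i))\<^sup>2 + (cmod (v j))\<^sup>2) / 2)"
  proof (rule sum_list_mono)
    show "cmod (v i) * cmod (v j) \<le> ((cmod (v i))\<^sup>2 + (cmod (v j))\<^sup>2) / 2" for v :: "'a \<Rightarrow> complex"
      using sum_squares_bound[of "cmod (v i)" "cmod (v j)"] by simp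
  qed
  also have "\<dots> = (Re (A i i) + Re (A j j)) / 2"
    unfolding diag by (induction vs) (auto simp: field_simps)
  also have "\<dots> \<le> (\<Sum>k\<in>UNIV. Re (A k k))"
    using member_le_sum[of i UNIV "\<lambda>k. Re (A k k)"] member_le_sum[of j UNIV "\<lambda>k. Re (A k k)"]
      pos_kernel_diag(2)[OF assms] by simp
  finally show ?thesis .
qed

section \<open>Positive operators\<close>

lemma dagger_add: "dagger (A + B) = dagger A + dagger B"
  by (simp add: dagger_def vec_eq_iff)

lemma dagger_diff: "dagger (A - B) = dagger A - dagger B"
  by (simp add: dagger_def vec_eq_iff)

lemma dagger_zero [simp]: "dagger 0 = 0"
  by (simp add: dagger_def vec_eq_iff)

lemma dagger_one [simp]: "dagger (mat 1) = mat 1"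
  by (auto simp: dagger_def vec_eq_iff mat_def)

lemma dagger_mult: "dagger (A ** B) = dagger B ** dagger A"
  by (simp add: dagger_def vec_eq_iff matrix_matrix_mult_def mult.commute)

lemma oper_mult_diff_left: "(A - B) ** C = A ** C - B ** (C :: 'q::finite oper)"
  by (simp add: vec_eq_iff matrix_matrix_mult_def sum_subtractf left_diff_distrib)

lemma oper_mult_zero [simp]: "0 ** C = (0 :: 'q::finite oper)" "C ** 0 = (0 :: 'q::finite oper)"
  by (simp_all add: vec_eq_iff matrix_matrix_mult_def)

lemma trace_zero [simp]: "trace (0 :: 'q::finite oper) = 0"
  by (simp add: trace_def)

lemma trace_mult_cycle: "trace (A ** B ** C ** D) = trace (B ** (C ** D ** (A :: 'q::finite oper)))"
  by (metis matrix_mul_assoc trace_mul_sym)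

lemma psd_iff_pos_kernel:
  fixes A :: "'q::finite oper"
  shows "psd A \<longleftrightarrow> pos_kernel (\<lambda>s t. A $ s $ t)"
proof -
  have "(\<Sum>s\<in>UNIV. cnj (v $ s) * (A *v v) $ s) = (\<Sum>s\<in>UNIV. \<Sum>t\<in>UNIV. cnj (v $ s) * A $ s $ t * v $ t)" for v
    by (simp add: matrix_vector_mult_def sum_distrib_left mult.assoc)
  then have form: "Re (\<Sum>s\<in>UNIV. cnj (v $ s) * (A *v v) $ s) = quad_form (\<lambda>s t. A $ s $ t) (($) v)" for v
    unfolding quad_form_def by simp
  have "(\<forall>v. 0 \<le> quad_form (\<lambda>s t. A $ s $ t) (($) v)) \<longleftrightarrow> (\<forall>x. 0 \<le> quad_form (\<lambda>s t. A $ s $ t) x)"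
  proof (intro iffI allI)
    fix x :: "('q \<Rightarrow> bool) \<Rightarrow> complex"
    assume "\<forall>v. 0 \<le> quad_form (\<lambda>s t. A $ s $ t) (($) v)"
    moreover have "($) (\<chi> i. x i) = x"
      by (rule ext) simp
    ultimately show "0 \<le> quad_form (\<lambda>s t. A $ s $ t) x"
      by metis
  qed blast
  then show ?thesis
    unfolding psd_def form pos_kernel_def by (simp add: dagger_def vec_eq_iff)
qed

lemma psd_dagger: "psd A \<Longrightarrow> dagger A = A"
  by (simp add: psd_def)

text \<open>The unnormalized pure state with amplitude vector \<open>v\<close>.\<close>

definition outer :: "(('q \<Rightarrow> bool) \<Rightarrow> complex) \<Rightarrow> 'q::finite oper" where
  "outer v = (\<chi> s t. v s * cnj (v t))"

lemma psd_outer: "psd (outer v)"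
  using pos_kernel_rank_one_sumI[of "[v]"] by (simp add: psd_iff_pos_kernel outer_def)

text \<open>Obtained from Schur complements, with no orthogonality among the vectors. It reduces
  positivity claims to pure states.\<close>

lemma psd_outer_sum:
  assumes "psd \<rho>"
  obtains vs where "\<rho> = (\<Sum>v\<leftarrow>vs. outer v)"
proof -
  obtain vs where "\<And>s t. \<rho> $ s $ t = (\<Sum>v\<leftarrow>vs. v s * cnj (v t))"
    using pos_kernel_rank_one_sum assms unfolding psd_iff_pos_kernel by blast
  moreover have "(\<Sum>v\<leftarrow>vs. outer v) $ s $ t = (\<Sum>v\<leftarrow>vs. v s * cnj (v t))" for s t
    by (induction vs) (simp_all add: outer_def)
  ultimately have "\<rho> = (\<Sum>v\<leftarrow>vs. outer v)"
    by (simp add: vec_eq_iff)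
  then show thesis by (rule that)
qed

lemma trace_outer: "Re (trace (A ** outer v)) = quad_form (\<lambda>s t. A $ s $ t) v"
  unfolding quad_form_def trace_def matrix_matrix_mult_def outer_def vec_lambda_beta
  by (simp only: mult_ac)

text \<open>By the decomposition of \<rho>, the trace is a sum of values of the form of
  \<open>A\<close>.\<close>

lemma psd_trace_nonneg:
  assumes "psd A" "psd \<rho>"
  shows "0 \<le> Re (trace (A ** \<rho>))"
proof -
  obtain vs where "\<rho> = (\<Sum>v\<leftarrow>vs. outer v)"
    using psd_outer_sum[OF assms(2)] .
  moreover have "0 \<le> Re (trace (A ** (\<Sum>v\<leftarrow>vs. outer v)))"
  proof (induction vs)
    case (Cons v vs)
    have "0 \<le> Re (trace (A ** outer v))"
      using assms(1) by (simp add: trace_outer psd_iff_pos_kernel pos_kernel_def)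
    with Cons show ?case
      by (simp add: matrix_add_ldistrib trace_add)
  qed simp
  ultimately show ?thesis by simp
qed

text \<open>Pure states suffice as tests. Hermiticity is a separate hypothesis because the real part
  of the trace does not see the antihermitian part of \<open>A\<close>.\<close>

lemma psdI_trace:
  assumes A: "dagger A = A" and pos: "\<And>\<rho>. psd \<rho> \<Longrightarrow> 0 \<le> Re (trace (A ** \<rho>))"
  shows "psd A"
proof -
  have "0 \<le> quad_form (\<lambda>s t. A $ s $ t) v" for v
    using pos[OF psd_outer] by (simp add: trace_outer)
  moreover have "cnj (A $ t $ s) = A $ s $ t" for s t
  proof -
    have "dagger A $ s $ t = A $ s $ t" using A by simp
    then show ?thesis by (simp add: dagger_def)
  qed
  ultimately show "psd A"
    by (simp add: psd_iff_pos_kernel pos_kernel_def)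
qed

lemma psd_zero [simp]: "psd 0"
  by (rule psdI_trace) simp_all

lemma psd_add: "psd A \<Longrightarrow> psd B \<Longrightarrow> psd (A + B)"
  by (rule psdI_trace) (simp_all add: psd_dagger psd_trace_nonneg dagger_add oper_mult_add_left trace_add)

lemma psd_conj:
  assumes "psd \<rho>" shows "psd (A ** \<rho> ** dagger A)"
proof -
  have psd_outer_conj: "\<exists>w. A ** outer v ** dagger A = outer w" for v
  proof
    show "A ** outer v ** dagger A = outer (\<lambda>s. \<Sum>t\<in>UNIV. A $ s $ t * v t)"
      by (simp add: vec_eq_iff outer_def matrix_matrix_mult_def dagger_def sum_distrib_left
          sum_distrib_right mult_ac)
  qed
  obtain vs where "\<rho> = (\<Sum>v\<leftarrow>vs. outer v)"
    using psd_outer_sum[OF assms] .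
  moreover have "psd (A ** (\<Sum>v\<leftarrow>vs. outer v) ** dagger A)"
  proof (induction vs)
    case (Cons v vs)
    have "psd (A ** outer v ** dagger A)"
      using psd_outer_conj[of v] by (auto simp: psd_outer)
    with Cons show ?case
      by (simp add: matrix_add_ldistrib oper_mult_add_left psd_add)
  qed simp
  ultimately show ?thesis by simp
qed

lemma psd_one: "psd (mat 1 :: 'q::finite oper)"
proof -
  have eq: "cnj (x i) * mat 1 $ i $ j * x j = (if i = j then of_real ((cmod (x i))\<^sup>2) else 0)"
    for x :: "('q \<Rightarrow> bool) \<Rightarrow> complex" and i j
    by (simp add: mat_def complex_norm_square mult.commute del: of_real_power)
  have "0 \<le> quad_form (\<lambda>s t. mat 1 $ s $ t) x" for x :: "('q \<Rightarrow> bool) \<Rightarrow> complex"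
    unfolding quad_form_def eq by (simp add: sum_nonneg)
  moreover have "cnj (mat 1 $ j $ i) = (mat 1 $ i $ j :: complex)" for i j :: "'q \<Rightarrow> bool"
    by (simp add: mat_def)
  ultimately show ?thesis
    unfolding psd_iff_pos_kernel pos_kernel_def by blast
qed

lemma psd_trace: "psd \<rho> \<Longrightarrow> 0 \<le> Re (trace \<rho>)"
  using psd_trace_nonneg[OF psd_one, of \<rho>] by simp

text \<open>The factor counts matrix entries; the bound is crude but makes traces control
  norms.\<close>

lemma psd_norm_le:
  assumes "psd (A :: 'q::finite oper)"
  shows "norm A \<le> real (CARD('q \<Rightarrow> bool) ^ 2) * Re (trace A)"
proof -
  have "norm A \<le> (\<Sum>s\<in>UNIV. \<Sum>t\<in>UNIV. norm (A $ s $ t))"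
    unfolding norm_vec_def by (intro order.trans[OF L2_set_le_sum] sum_mono) auto
  also have "\<dots> \<le> (\<Sum>s\<in>(UNIV::('q \<Rightarrow> bool) set). \<Sum>t\<in>(UNIV::('q \<Rightarrow> bool) set). Re (trace A))"
    using pos_kernel_norm_le assms unfolding psd_iff_pos_kernel trace_def Re_sum by (intro sum_mono) blast
  finally show ?thesis
    by (simp add: power2_eq_square)
qed

text \<open>Passing to the trace pairing turns the order into inequalities of expectations, where
  adjoints can be moved onto the state.\<close>

lemma lowner_le_trace:
  "A \<sqsubseteq>\<^sub>L B \<longleftrightarrow> dagger (B - A) = B - A \<and> (\<forall>\<rho>. psd \<rho> \<longrightarrow> Re (trace (A ** \<rho>)) \<le> Re (trace (B ** \<rho>)))"
proof -
  have "psd (B - A) \<longleftrightarrow> dagger (B - A) = B - A \<and> (\<forall>\<rho>. psd \<rho> \<longrightarrow> 0 \<le> Re (trace ((B - A) ** \<rho>)))"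
    using psdI_trace[of "B - A"] psd_dagger[of "B - A"] psd_trace_nonneg[of "B - A"] by blast
  then show ?thesis
    unfolding lowner_le_def by (simp add: oper_mult_diff_left trace_sub)
qed

lemma quantum_predicateD:
  assumes "quantum_predicate M"
  shows "psd M" "dagger M = M" "\<And>\<rho>. psd \<rho> \<Longrightarrow> 0 \<le> Re (trace (M ** \<rho>))"
    "\<And>\<rho>. psd \<rho> \<Longrightarrow> Re (trace (M ** \<rho>)) \<le> Re (trace \<rho>)"
proof -
  show "psd M" using assms by (simp add: quantum_predicate_def lowner_le_def)
  then show "dagger M = M" "\<And>\<rho>. psd \<rho> \<Longrightarrow> 0 \<le> Re (trace (M ** \<rho>))"
    by (simp_all add: psd_dagger psd_trace_nonneg)
  show "\<And>\<rho>. psd \<rho> \<Longrightarrow> Re (trace (M ** \<rho>)) \<le> Re (trace \<rho>)"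
    using assms unfolding quantum_predicate_def lowner_le_trace by simp
qed

lemma quantum_predicateI:
  assumes "psd M" "\<And>\<rho>. psd \<rho> \<Longrightarrow> Re (trace (M ** \<rho>)) \<le> Re (trace \<rho>)"
  shows "quantum_predicate M"
  unfolding quantum_predicate_def lowner_le_trace
  using assms psd_dagger[OF assms(1)] by (simp add: dagger_diff psd_trace_nonneg)

section \<open>Completely positive maps\<close>

text \<open>Complete positivity in the form for which \<open>superop_adjoint\<close> is meaningful.
  The trace bound is added in \<open>quantum_operation\<close>.\<close>

definition is_kraus :: "'q::finite superop \<Rightarrow> bool" where
  "is_kraus \<E> \<longleftrightarrow> (\<exists>Es. \<E> = kraus_map Es)"

lemma kraus_map_Nil: "kraus_map [] \<rho> = 0"
  by (simp add: kraus_map_def)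

lemma kraus_map_Cons: "kraus_map (E # Es) \<rho> = E ** \<rho> ** dagger E + kraus_map Es \<rho>"
  by (simp add: kraus_map_def)

lemma kraus_map_append: "kraus_map (Es @ Fs) \<rho> = kraus_map Es \<rho> + kraus_map Fs \<rho>"
  by (simp add: kraus_map_def)

lemma kraus_map_add: "kraus_map Es (A + B) = kraus_map Es A + kraus_map Es B"
  by (induction Es) (simp_all add: kraus_map_Nil kraus_map_Cons matrix_add_ldistrib oper_mult_add_left)

lemma is_kraus_id: "is_kraus id"
proof -
  have "id = kraus_map [mat 1]"
    by (rule ext) (simp add: kraus_map_def)
  then show ?thesis
    unfolding is_kraus_def by blast
qed

lemma is_kraus_zero: "is_kraus (\<lambda>_. 0)"
proof -
  have "(\<lambda>_. 0) = kraus_map []"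
    by (rule ext) (simp add: kraus_map_def)
  then show ?thesis
    unfolding is_kraus_def by blast
qed

lemma is_kraus_conj: "is_kraus (\<lambda>\<rho>. A ** \<rho> ** dagger A)"
proof -
  have "(\<lambda>\<rho>. A ** \<rho> ** dagger A) = kraus_map [A]"
    by (rule ext) (simp add: kraus_map_def)
  then show ?thesis
    unfolding is_kraus_def by blast
qed

lemma is_kraus_add:
  assumes "is_kraus \<E>" "is_kraus \<F>"
  shows "is_kraus (\<lambda>\<rho>. \<E> \<rho> + \<F> \<rho>)"
proof -
  obtain Es Fs where "\<E> = kraus_map Es" "\<F> = kraus_map Fs"
    using assms by (auto simp: is_kraus_def)
  then have "(\<lambda>\<rho>. \<E> \<rho> + \<F> \<rho>) = kraus_map (Es @ Fs)"
    by (simp add: fun_eq_iff kraus_map_append)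
  then show ?thesis
    unfolding is_kraus_def by blast
qed

lemma is_kraus_sum:
  assumes "finite I" "\<And>i. i \<in> I \<Longrightarrow> is_kraus (\<E> i)"
  shows "is_kraus (\<lambda>\<rho>. \<Sum>i\<in>I. \<E> i \<rho>)"
  using assms by (induction I rule: finite_induct) (simp_all add: is_kraus_zero is_kraus_add)

text \<open>The Kraus operators of a composite are all products \<open>F ** E\<close>.\<close>

lemma is_kraus_comp:
  assumes "is_kraus \<F>" "is_kraus \<E>"
  shows "is_kraus (\<lambda>\<rho>. \<F> (\<E> \<rho>))"
proof -
  obtain Es Fs where EF: "\<E> = kraus_map Es" "\<F> = kraus_map Fs"
    using assms by (auto simp: is_kraus_def)
  have single: "kraus_map Fs (E ** \<rho> ** dagger E) = kraus_map (map (\<lambda>F. F ** E) Fs) \<rho>" for E \<rho>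
    by (induction Fs) (simp_all add: kraus_map_Nil kraus_map_Cons dagger_mult matrix_mul_assoc)
  have zero: "kraus_map Fs 0 = 0"
    by (induction Fs) (simp_all add: kraus_map_Nil kraus_map_Cons)
  have "kraus_map Fs (kraus_map Es \<rho>) = kraus_map (concat (map (\<lambda>E. map (\<lambda>F. F ** E) Fs) Es)) \<rho>" for \<rho>
    by (induction Es) (simp_all add: kraus_map_Nil kraus_map_Cons kraus_map_add kraus_map_append single zero)
  then have "(\<lambda>\<rho>. \<F> (\<E> \<rho>)) = kraus_map (concat (map (\<lambda>E. map (\<lambda>F. F ** E) Fs) Es))"
    unfolding EF by (rule ext)
  then show ?thesis
    unfolding is_kraus_def by blast
qed

lemma is_kraus_psd:
  assumes "is_kraus \<E>" "psd \<rho>"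
  shows "psd (\<E> \<rho>)"
proof -
  have "psd (kraus_map Es \<rho>)" for Es
    by (induction Es) (simp_all add: kraus_map_Nil kraus_map_Cons psd_add psd_conj assms(2))
  then show ?thesis
    using assms(1) by (auto simp: is_kraus_def)
qed

lemma is_kraus_adjoint: "is_kraus \<E> \<Longrightarrow> is_kraus (superop_adjoint \<E>)"
  unfolding is_kraus_def by (auto simp: superop_adjoint_kraus_map)

lemma trace_superop_adjoint:
  "is_kraus \<E> \<Longrightarrow> trace (superop_adjoint \<E> M ** \<rho>) = trace (M ** \<E> \<rho>)"
  unfolding is_kraus_def by (auto simp: superop_adjoint_kraus_map trace_kraus_map_dual)

text \<open>The trace pairing is nondegenerate, so a candidate for the adjoint only has to satisfy
  duality. The preconditions of the individual statements are computed this way.\<close>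

lemma superop_adjointI:
  assumes "is_kraus \<E>" "\<And>\<rho>. trace (A ** \<rho>) = trace (M ** \<E> \<rho>)"
  shows "superop_adjoint \<E> M = A"
  by (rule trace_dual_unique) (simp add: trace_superop_adjoint assms)

text \<open>\<open>J\<close> is the Choi matrix: \<open>J (u, s) (v, t)\<close> is the entry \<open>(u, v)\<close> of \<open>\<E>(|s\<rangle>\<langle>t|)\<close>.\<close>

lemma is_kraus_iff_choi:
  fixes \<E> :: "'q::finite superop"
  shows "is_kraus \<E> \<longleftrightarrow> (\<exists>J. pos_kernel J \<and>
    (\<forall>\<rho> u v. \<E> \<rho> $ u $ v = (\<Sum>s\<in>UNIV. \<Sum>t\<in>UNIV. \<rho> $ s $ t * J (u, s) (v, t))))"
proof
  have entry: "kraus_map Es \<rho> $ u $ v =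
    (\<Sum>s\<in>UNIV. \<Sum>t\<in>UNIV. \<rho> $ s $ t * (\<Sum>E\<leftarrow>Es. E $ u $ s * cnj (E $ v $ t)))"
    for Es :: "'q oper list" and \<rho> u v
  proof (induction Es)
    case (Cons E Es)
    have "(E ** \<rho> ** dagger E) $ u $ v = (\<Sum>t\<in>UNIV. \<Sum>s\<in>UNIV. \<rho> $ s $ t * (E $ u $ s * cnj (E $ v $ t)))"
      by (simp add: matrix_matrix_mult_def dagger_def sum_distrib_left sum_distrib_right mult_ac)
    also have "\<dots> = (\<Sum>s\<in>UNIV. \<Sum>t\<in>UNIV. \<rho> $ s $ t * (E $ u $ s * cnj (E $ v $ t)))"
      by (rule sum.swap)
    finally show ?case
      using Cons by (simp add: kraus_map_Cons distrib_left sum.distrib)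
  qed (simp add: kraus_map_Nil)
  {
    assume "is_kraus \<E>"
    then obtain Es where Es: "\<E> = kraus_map Es"
      by (auto simp: is_kraus_def)
    \<comment> \<open>Kraus operators are read as vectors indexed by pairs.\<close>
    define J where "J = (\<lambda>p q. \<Sum>v\<leftarrow>map (\<lambda>E p. E $ fst p $ snd p) Es. v p * cnj (v q))"
    have "pos_kernel J"
      unfolding J_def by (rule pos_kernel_rank_one_sumI)
    moreover have "\<E> \<rho> $ u $ v = (\<Sum>s\<in>UNIV. \<Sum>t\<in>UNIV. \<rho> $ s $ t * J (u, s) (v, t))" for \<rho> u v
      unfolding Es entry J_def by (simp add: o_def)
    ultimately show "\<exists>J. pos_kernel J \<and>
      (\<forall>\<rho> u v. \<E> \<rho> $ u $ v = (\<Sum>s\<in>UNIV. \<Sum>t\<in>UNIV. \<rho> $ s $ t * J (u, s) (v, t)))"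
      by blast
  }
  {
    assume "\<exists>J. pos_kernel J \<and>
      (\<forall>\<rho> u v. \<E> \<rho> $ u $ v = (\<Sum>s\<in>UNIV. \<Sum>t\<in>UNIV. \<rho> $ s $ t * J (u, s) (v, t)))"
    then obtain J where J: "pos_kernel J"
      "\<And>\<rho> u v. \<E> \<rho> $ u $ v = (\<Sum>s\<in>UNIV. \<Sum>t\<in>UNIV. \<rho> $ s $ t * J (u, s) (v, t))"
      by blast
    obtain vs where vs: "\<And>p q. J p q = (\<Sum>v\<leftarrow>vs. v p * cnj (v q))"
      using pos_kernel_rank_one_sum[OF J(1)] by blast
    \<comment> \<open>Conversely, each vector on pairs is reshaped into a matrix, which serves as a
      Kraus operator.\<close>
    have "\<E> \<rho> = kraus_map (map (\<lambda>v. \<chi> u s. v (u, s)) vs) \<rho>" for \<rho>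
      unfolding vec_eq_iff J(2) entry vs by (simp add: o_def)
    then have "\<E> = kraus_map (map (\<lambda>v. \<chi> u s. v (u, s)) vs)"
      by (rule ext)
    then show "is_kraus \<E>"
      unfolding is_kraus_def by blast
  }
qed

text \<open>The trace of the Choi matrix of \<open>\<E> i\<close> is the trace of
  \<open>\<E> i (mat 1)\<close>, and it bounds every entry. Hence one scalar series gives
  convergence of the Choi matrices, and their sum is again positive.\<close>

lemma is_kraus_suminf:
  fixes \<E> :: "nat \<Rightarrow> 'q::finite superop"
  assumes kraus: "\<And>i. is_kraus (\<E> i)" and summable: "summable (\<lambda>i. Re (trace (\<E> i (mat 1))))"
  shows "is_kraus (\<lambda>\<rho>. \<Sum>i. \<E> i \<rho>)" and "summable (\<lambda>i. \<E> i \<rho>)"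
proof -
  have "\<forall>i. \<exists>J. pos_kernel J \<and>
    (\<forall>\<rho> u v. \<E> i \<rho> $ u $ v = (\<Sum>s\<in>UNIV. \<Sum>t\<in>UNIV. \<rho> $ s $ t * J (u, s) (v, t)))"
    using kraus unfolding is_kraus_iff_choi by blast
  from choice[OF this] obtain J where "\<forall>i. pos_kernel (J i) \<and>
    (\<forall>\<rho> u v. \<E> i \<rho> $ u $ v = (\<Sum>s\<in>UNIV. \<Sum>t\<in>UNIV. \<rho> $ s $ t * J i (u, s) (v, t)))"
    by blast
  then have J: "\<And>i. pos_kernel (J i)"
    "\<And>i \<rho> u v. \<E> i \<rho> $ u $ v = (\<Sum>s\<in>UNIV. \<Sum>t\<in>UNIV. \<rho> $ s $ t * J i (u, s) (v, t))"
    by blast+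
  have tr: "Re (trace (\<E> i (mat 1))) = (\<Sum>p\<in>UNIV. Re (J i p p))" for i
  proof -
    have "trace (\<E> i (mat 1)) = (\<Sum>u\<in>UNIV. \<Sum>s\<in>UNIV. J i (u, s) (u, s))"
      unfolding trace_def J(2) by (simp add: mat_def if_distrib[of "\<lambda>y. y * _"] cong: if_cong)
    also have "\<dots> = (\<Sum>p\<in>UNIV. J i p p)"
      by (simp add: sum.cartesian_product flip: UNIV_Times_UNIV)
    finally show ?thesis by simp
  qed
  have J_summable: "summable (\<lambda>i. J i p q)" for p q
    by (rule summable_comparison_test'[OF summable, of 0]) (simp add: tr pos_kernel_norm_le J(1))
  define K where "K p q = (\<Sum>i. J i p q)" for p q
  have K: "(\<lambda>i. J i p q) sums K p q" for p q
    unfolding K_def by (rule summable_sums[OF J_summable])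
  have entry: "(\<lambda>i. \<E> i \<rho> $ u $ v) sums (\<Sum>s\<in>UNIV. \<Sum>t\<in>UNIV. \<rho> $ s $ t * K (u, s) (v, t))" for \<rho> u v
    unfolding J(2) by (intro sums_sum sums_mult K)
  have sums: "(\<lambda>i. \<E> i \<rho>) sums (\<chi> u v. \<Sum>s\<in>UNIV. \<Sum>t\<in>UNIV. \<rho> $ s $ t * K (u, s) (v, t))" for \<rho>
    using entry[of \<rho>] unfolding sums_def by (intro vec_tendstoI) simp
  then show "summable (\<lambda>i. \<E> i \<rho>)"
    by (rule sums_summable)
  have "pos_kernel K"
    unfolding pos_kernel_def
  proof (intro conjI allI)
    fix p q
    have "(\<lambda>i. cnj (J i q p)) sums cnj (K q p)"
      using K by (simp add: sums_cnj)
    then have "(\<lambda>i. J i p q) sums cnj (K q p)"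
      by (simp add: pos_kernel_herm[OF J(1)])
    then show "cnj (K q p) = K p q"
      using K sums_unique2 by blast
  next
    fix x
    have "(\<lambda>i. cnj (x p) * J i p q * x q) sums (cnj (x p) * K p q * x q)" for p q
      by (rule sums_mult2[OF sums_mult[OF K]])
    \<comment> \<open>For fixed \<open>x\<close> the form is a finite sum of scaled entries, so the
      series of its values sums to the form of \<open>K\<close>.\<close>
    from sums_Re[OF sums_sum[OF sums_sum[OF this]]]
    have sums_K: "(\<lambda>i. quad_form (J i) x) sums quad_form K x"
      unfolding quad_form_def .
    have nonneg: "0 \<le> quad_form (J i) x" for i
      using J(1)[of i] unfolding pos_kernel_def by blast
    show "0 \<le> quad_form K x"
      by (rule sums_le[OF nonneg sums_zero sums_K])
  qed
  moreover have "(\<Sum>i. \<E> i \<rho>) $ u $ v = (\<Sum>s\<in>UNIV. \<Sum>t\<in>UNIV. \<rho> $ s $ t * K (u, s) (v, t))" for \<rho> u v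
    by (simp add: sums_unique[OF sums, symmetric])
  ultimately show "is_kraus (\<lambda>\<rho>. \<Sum>i. \<E> i \<rho>)"
    unfolding is_kraus_iff_choi by blast
qed

text \<open>The trace bound ranges over all positive operators, not only those of trace at most one,
  so that it can be applied to the identity.\<close>

definition quantum_operation :: "'q::finite superop \<Rightarrow> bool" where
  "quantum_operation \<E> \<longleftrightarrow> is_kraus \<E> \<and> (\<forall>\<rho>. psd \<rho> \<longrightarrow> Re (trace (\<E> \<rho>)) \<le> Re (trace \<rho>))"

lemma quantum_operationD:
  assumes "quantum_operation \<E>"
  shows "is_kraus \<E>" "psd \<rho> \<Longrightarrow> psd (\<E> \<rho>)" "psd \<rho> \<Longrightarrow> Re (trace (\<E> \<rho>)) \<le> Re (trace \<rho>)"
    "partial_density \<rho> \<Longrightarrow> partial_density (\<E> \<rho>)"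
  using assms is_kraus_psd[of \<E> \<rho>] by (auto simp: quantum_operation_def partial_density_def intro: order.trans)

lemma quantum_operation_id: "quantum_operation id"
  by (simp add: quantum_operation_def is_kraus_id)

lemma quantum_operation_zero: "quantum_operation (\<lambda>_. 0)"
  by (simp add: quantum_operation_def is_kraus_zero psd_trace)

lemma quantum_operation_comp:
  assumes "quantum_operation \<F>" "quantum_operation \<E>"
  shows "quantum_operation (\<lambda>\<rho>. \<F> (\<E> \<rho>))"
  unfolding quantum_operation_def
proof (intro conjI allI impI)
  show "is_kraus (\<lambda>\<rho>. \<F> (\<E> \<rho>))"
    by (rule is_kraus_comp[OF quantum_operationD(1)[OF assms(1)] quantum_operationD(1)[OF assms(2)]])
  fix \<rho> :: "'a oper" assume "psd \<rho>"
  then show "Re (trace (\<F> (\<E> \<rho>))) \<le> Re (trace \<rho>)"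
    using quantum_operationD(3)[OF assms(1), of "\<E> \<rho>"] quantum_operationD(2,3)[OF assms(2), of \<rho>] by simp
qed

text \<open>Under the trace pairing, the trace bound on \<E> becomes the bound by the identity for
  its adjoint.\<close>

lemma quantum_predicate_adjoint:
  assumes "quantum_operation \<E>" "quantum_predicate M"
  shows "quantum_predicate (superop_adjoint \<E> M)"
proof (rule quantum_predicateI)
  show "psd (superop_adjoint \<E> M)"
    by (rule is_kraus_psd[OF is_kraus_adjoint[OF quantum_operationD(1)[OF assms(1)]] quantum_predicateD(1)[OF assms(2)]])
  fix \<rho> :: "'a oper" assume \<rho>: "psd \<rho>"
  show "Re (trace (superop_adjoint \<E> M ** \<rho>)) \<le> Re (trace \<rho>)"
    using quantum_operationD(2,3)[OF assms(1) \<rho>] quantum_predicateD(4)[OF assms(2), of "\<E> \<rho>"]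
    by (simp add: trace_superop_adjoint quantum_operationD(1)[OF assms(1)])
qed

section \<open>Programs denote quantum operations\<close>

lemma trace_sum_mult_left:
  "trace ((\<Sum>i\<in>I. A i) ** (\<rho> :: 'q::finite oper)) = (\<Sum>i\<in>I. trace (A i ** \<rho>))"
  by (induction I rule: infinite_finite_induct) (simp_all add: oper_mult_add_left trace_add)

lemma trace_sum_mult_right:
  "trace ((M :: 'q::finite oper) ** (\<Sum>i\<in>I. A i)) = (\<Sum>i\<in>I. trace (M ** A i))"
  by (induction I rule: infinite_finite_induct) (simp_all add: matrix_add_ldistrib trace_add)

lemma bounded_linear_trace: "bounded_linear (\<lambda>A. Re (trace (M ** (A :: 'q::finite oper))))"
proof -
  have "linear (\<lambda>A. Re (trace (M ** A)))"
  proof (rule linearI)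
    show "Re (trace (M ** (A + B))) = Re (trace (M ** A)) + Re (trace (M ** B))" for A B
      by (simp add: matrix_add_ldistrib trace_add)
    have "trace (M ** (r *\<^sub>R A)) = of_real r * trace (M ** A)" for r A
      by (simp add: trace_def matrix_matrix_mult_def sum_distrib_left scaleR_conv_of_real[where 'a = complex] mult_ac)
    then show "Re (trace (M ** (r *\<^sub>R A))) = r *\<^sub>R Re (trace (M ** A))" for r A
      by simp
  qed
  then show ?thesis
    by (simp add: linear_conv_bounded_linear)
qed

lemmas sums_trace = bounded_linear.sums[OF bounded_linear_trace]
lemmas tendsto_trace = bounded_linear.tendsto[OF bounded_linear_trace]

section \<open>Register operators on the global space\<close>

lemma finite_bits [simp]: "finite (bits n)"
  using finite_lists_length_eq[of "UNIV :: bool set" n] by (simp add: bits_def)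

lemma map_in_bits [simp]: "map s qs \<in> bits (length qs)"
  by (simp add: bits_def)

lemma replicate_in_bits [simp]: "replicate n b \<in> bits n"
  by (simp add: bits_def)

text \<open>The inverse overwrites \<open>s\<close> on the register by a bit string. Distinctness is
  essential: a repeated variable cannot receive two different bits.\<close>

lemma bij_betw_bits:
  assumes "distinct qs"
  shows "bij_betw (\<lambda>u. map u qs) {u. \<forall>q. q \<notin> set qs \<longrightarrow> s q = u q} (bits (length qs))"
  unfolding bij_betw_def
proof
  show "inj_on (\<lambda>u. map u qs) {u. \<forall>q. q \<notin> set qs \<longrightarrow> s q = u q}"
  proof (intro inj_onI ext)
    fix u u' q
    assume u: "u \<in> {u. \<forall>q. q \<notin> set qs \<longrightarrow> s q = u q}" "u' \<in> {u. \<forall>q. q \<notin> set qs \<longrightarrow> s q = u q}"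
      and "map u qs = map u' qs"
    then have "\<forall>q\<in>set qs. u q = u' q"
      by simp
    with u show "u q = u' q"
      by (cases "q \<in> set qs") auto
  qed
  show "(\<lambda>u. map u qs) ` {u. \<forall>q. q \<notin> set qs \<longrightarrow> s q = u q} = bits (length qs)"
  proof (intro equalityI subsetI)
    fix y assume "y \<in> bits (length qs)"
    then have y: "length y = length qs" by (simp add: bits_def)
    \<comment> \<open>Outside the register the lookup fails and the default is the value of
      \<open>s\<close>.\<close>
    define u where "u q = (case map_of (zip qs y) q of None \<Rightarrow> s q | Some b \<Rightarrow> b)" for q
    have "map u qs = y"
      by (rule nth_equalityI) (simp_all add: y u_def map_of_zip_nth assms)
    moreover have "s q = u q" if "q \<notin> set qs" for q
    proof -
      have "map_of (zip qs y) q = None"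
        using that y by (simp add: map_of_zip_is_None)
      then show ?thesis by (simp add: u_def)
    qed
    ultimately show "y \<in> (\<lambda>u. map u qs) ` {u. \<forall>q. q \<notin> set qs \<longrightarrow> s q = u q}"
      by blast
  qed auto
qed

text \<open>Only intermediate assignments agreeing with \<open>s\<close> off the register
  contribute, and \<open>bij_betw_bits\<close> turns the sum over them into the sum over bit strings
  in \<open>reg_mult\<close>.\<close>

lemma lift_op_mult:
  assumes "distinct qs"
  shows "lift_op qs A ** lift_op qs B = lift_op qs (reg_mult (length qs) A B)"
proof -
  have "(lift_op qs A ** lift_op qs B) $ s $ t = lift_op qs (reg_mult (length qs) A B) $ s $ t" for s t
  proof -
    let ?U = "{u. \<forall>q. q \<notin> set qs \<longrightarrow> s q = u q}"
    have "(lift_op qs A ** lift_op qs B) $ s $ t =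
      (\<Sum>u\<in>?U. A (map s qs) (map u qs) * (if \<forall>q. q \<notin> set qs \<longrightarrow> u q = t q then B (map u qs) (map t qs) else 0))"
      unfolding matrix_matrix_mult_def lift_op_def vec_lambda_beta
      by (rule sum.mono_neutral_cong_right) auto
    \<comment> \<open>For such \<open>u\<close>, agreement with \<open>t\<close> off the register
      means agreement of \<open>s\<close> with \<open>t\<close>, a condition independent of
      \<open>u\<close>.\<close>
    also have "\<dots> = (\<Sum>u\<in>?U. (\<lambda>y. A (map s qs) y * (if \<forall>q. q \<notin> set qs \<longrightarrow> s q = t q then B y (map t qs) else 0)) (map u qs))"
      by (rule sum.cong) auto
    also have "\<dots> = (\<Sum>y\<in>bits (length qs). A (map s qs) y * (if \<forall>q. q \<notin> set qs \<longrightarrow> s q = t q then B y (map t qs) else 0))"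
      by (rule sum.reindex_bij_betw[OF bij_betw_bits[OF assms]])
    also have "\<dots> = lift_op qs (reg_mult (length qs) A B) $ s $ t"
    proof -
      define agree where "agree \<longleftrightarrow> (\<forall>q. q \<notin> set qs \<longrightarrow> s q = t q)"
      show ?thesis
        unfolding lift_op_def vec_lambda_beta reg_mult_def agree_def[symmetric]
        by (cases agree) simp_all
    qed
    finally show ?thesis .
  qed
  then show ?thesis by (simp add: vec_eq_iff)
qed

lemma lift_op_cong: "reg_eq (length qs) A B \<Longrightarrow> lift_op qs A = lift_op qs B"
  by (auto simp: lift_op_def vec_eq_iff reg_eq_def)

lemma lift_op_dagger: "dagger (lift_op qs A) = lift_op qs (reg_dagger A)"
  by (auto simp: lift_op_def vec_eq_iff reg_dagger_def dagger_def)

lemma lift_op_ketbra_dagger: "dagger (lift_op qs (ketbra a b)) = lift_op qs (ketbra b a)"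
proof -
  have "reg_dagger (ketbra a b) = ketbra b a"
    by (auto simp: fun_eq_iff reg_dagger_def ketbra_def)
  then show ?thesis by (simp add: lift_op_dagger)
qed

lemma eq_iff_map_eq: "(\<forall>q. q \<notin> set qs \<longrightarrow> s q = t q) \<Longrightarrow> map s qs = map t qs \<longleftrightarrow> s = t"
  by (auto simp: fun_eq_iff)

lemma lift_op_id: "lift_op qs reg_id = mat 1"
  by (auto simp: lift_op_def vec_eq_iff reg_id_def mat_def fun_eq_iff)

lemma lift_op_add: "lift_op qs (reg_add A B) = lift_op qs A + lift_op qs B"
  by (auto simp: lift_op_def vec_eq_iff reg_add_def)

lemma lift_op_projector:
  assumes "distinct qs" "reg_projector (length qs) P"
  shows "dagger (lift_op qs P) = lift_op qs P" "lift_op qs P ** lift_op qs P = lift_op qs P"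
  using assms lift_op_cong[of qs "reg_dagger P" P] lift_op_cong[of qs "reg_mult (length qs) P P" P]
  by (simp_all add: reg_projector_def lift_op_dagger lift_op_mult)

text \<open>Cyclicity of the trace: the same operator multiplies on both sides, so the map is its
  own dual. This is why the rules apply measurement branches to predicates unchanged.\<close>

lemma trace_proj_so_adjoint: "trace (proj_so qs P M ** \<rho>) = trace (M ** proj_so qs P \<rho>)"
  by (simp add: proj_so_def trace_mult_cycle)

text \<open>Idempotence and cyclicity give
  \<open>trace (proj_so qs P \<rho>) = trace (lift_op qs P ** \<rho>)\<close>, and the lifted
  projectors add up to the identity. Neither branch increases the trace of a positive operator,
  because the other branch has nonnegative trace.\<close>

lemma proj_so_measurement:
  assumes "distinct qs" "reg_proj_meas (length qs) P0 P1"
  shows "quantum_operation (proj_so qs P0)" "quantum_operation (proj_so qs P1)"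
    "trace (proj_so qs P0 \<rho>) + trace (proj_so qs P1 \<rho>) = trace \<rho>"
proof -
  have P: "reg_projector (length qs) P0" "reg_projector (length qs) P1"
    and sum: "reg_eq (length qs) (reg_add P0 P1) reg_id"
    using assms(2) by (simp_all add: reg_proj_meas_def)
  have one: "lift_op qs P0 + lift_op qs P1 = mat 1"
    using lift_op_cong[OF sum] by (simp add: lift_op_add lift_op_id)
  have tr: "trace (proj_so qs P \<rho>) = trace (lift_op qs P ** \<rho>)" if "reg_projector (length qs) P" for P \<rho>
    using trace_proj_so_adjoint[of qs P "mat 1" \<rho>] lift_op_projector(2)[OF assms(1) that]
    by (simp add: proj_so_def)
  have tr_sum: "trace (proj_so qs P0 \<rho>) + trace (proj_so qs P1 \<rho>) = trace \<rho>" for \<rho>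
  proof -
    have "trace (proj_so qs P0 \<rho>) + trace (proj_so qs P1 \<rho>) = trace ((lift_op qs P0 + lift_op qs P1) ** \<rho>)"
      by (simp add: tr P oper_mult_add_left trace_add)
    then show ?thesis by (simp add: one)
  qed
  then show "trace (proj_so qs P0 \<rho>) + trace (proj_so qs P1 \<rho>) = trace \<rho>" .
  have kraus: "is_kraus (proj_so qs P)" if "reg_projector (length qs) P" for P
  proof -
    have "proj_so qs P = (\<lambda>\<rho>. lift_op qs P ** \<rho> ** dagger (lift_op qs P))"
      by (rule ext) (simp add: proj_so_def lift_op_projector(1)[OF assms(1) that])
    then show ?thesis by (simp add: is_kraus_conj)
  qed
  have "0 \<le> Re (trace (proj_so qs P \<rho>))" if "reg_projector (length qs) P" "psd \<rho>" for P \<rho>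
    by (rule psd_trace[OF is_kraus_psd[OF kraus[OF that(1)] that(2)]])
  note nonneg = this[OF P(1)] this[OF P(2)]
  have "Re (trace (proj_so qs P0 \<rho>)) \<le> Re (trace \<rho>)" "Re (trace (proj_so qs P1 \<rho>)) \<le> Re (trace \<rho>)"
    if "psd \<rho>" for \<rho>
    using nonneg[OF that] arg_cong[OF tr_sum[of \<rho>], of Re] by simp_all
  then show "quantum_operation (proj_so qs P0)" "quantum_operation (proj_so qs P1)"
    using kraus P by (simp_all add: quantum_operation_def)
qed

lemma trace_init_pre: "trace (init_pre qs M ** \<rho>) = trace (M ** set0_so qs \<rho>)"
  by (simp add: init_pre_def set0_so_def trace_sum_mult_left trace_sum_mult_right trace_mult_cycle)

lemma sum_lift_op_ketbra: "(\<Sum>i\<in>bits (length qs). lift_op qs (ketbra i i)) = mat 1"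
proof -
  have "(\<Sum>i\<in>bits (length qs). lift_op qs (ketbra i i)) $ s $ t = (mat 1 :: 'a oper) $ s $ t" for s t
  proof (cases "\<forall>q. q \<notin> set qs \<longrightarrow> s q = t q")
    case True
    have "lift_op qs (ketbra i i) $ s $ t = (if map s qs = i then (if s = t then 1 else 0) else 0)" for i
      unfolding lift_op_def ketbra_def vec_lambda_beta
      using True eq_iff_map_eq[OF True] by (auto simp del: map_eq_conv)
    then show ?thesis by (simp add: mat_def)
  next
    case False
    then have "s \<noteq> t" by auto
    moreover have "lift_op qs (ketbra i i) $ s $ t = 0" for i
      by (simp only: lift_op_def vec_lambda_beta False if_False)
    ultimately show ?thesis by (simp add: mat_def)
  qed
  then show ?thesis by (simp add: vec_eq_iff)
qed

text \<open>In dual form this says that resetting the register preserves the trace.\<close>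

lemma init_pre_one:
  assumes "distinct qs"
  shows "init_pre qs (mat 1) = mat 1"
proof -
  have "reg_mult (length qs) (ketbra i (replicate (length qs) False)) (ketbra (replicate (length qs) False) i) = ketbra i i" for i
    by (auto simp: fun_eq_iff reg_mult_def ketbra_def if_distrib[of "\<lambda>y. y * _"] cong: if_cong)
  then show ?thesis
    by (simp add: init_pre_def lift_op_mult[OF assms] sum_lift_op_ketbra)
qed

lemma quantum_operation_set0:
  assumes "distinct qs"
  shows "quantum_operation (set0_so qs)"
proof -
  have "set0_so qs = (\<lambda>\<rho>. \<Sum>i\<in>bits (length qs).
    lift_op qs (ketbra (replicate (length qs) False) i) ** \<rho> ** dagger (lift_op qs (ketbra (replicate (length qs) False) i)))"
    by (rule ext) (simp add: set0_so_def lift_op_ketbra_dagger)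
  moreover have "is_kraus \<dots>"
    by (rule is_kraus_sum) (simp_all add: is_kraus_conj)
  moreover have "trace (set0_so qs \<rho>) = trace \<rho>" for \<rho>
    using trace_init_pre[of qs "mat 1" \<rho>] by (simp add: init_pre_one[OF assms])
  ultimately show ?thesis
    by (simp add: quantum_operation_def)
qed

lemma quantum_operation_unitary:
  assumes "distinct qs" "reg_unitary (length qs) U"
  shows "quantum_operation (conj_by (lift_op qs U))"
proof -
  have "dagger (lift_op qs U) ** lift_op qs U = mat 1"
    using assms lift_op_cong[of qs "reg_mult (length qs) (reg_dagger U) U" reg_id]
    by (simp add: reg_unitary_def lift_op_dagger lift_op_mult lift_op_id)
  then have "trace (conj_by (lift_op qs U) \<rho>) = trace \<rho>" for \<rho>
    using trace_mult_cycle[of "dagger (lift_op qs U)" "mat 1" "lift_op qs U" \<rho>] by (simp add: conj_by_def)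
  moreover have "is_kraus (conj_by (lift_op qs U))"
    using is_kraus_conj[of "lift_op qs U"] by (simp add: conj_by_def[abs_def])
  ultimately show ?thesis
    by (simp add: quantum_operation_def)
qed

section \<open>The loop as a convergent series of quantum operations\<close>

definition loop_so :: "'q::finite superop \<Rightarrow> 'q superop \<Rightarrow> (nat \<Rightarrow> 'q superop) \<Rightarrow> 'q superop" where
  "loop_so E0 E1 \<eta> \<rho> = (\<Sum>i. E0 (loop_iter E1 \<eta> i \<rho>))"

text \<open>\<open>loop_iter\<close> appends rounds at the end; here the first round is split off
  instead, leaving the scheduler suffix.\<close>

lemma loop_iter_shift:
  "loop_iter E1 \<eta> (Suc i) \<rho> = loop_iter E1 (\<lambda>k. \<eta> (Suc k)) i (\<eta> 0 (E1 \<rho>))"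
  by (induction i) simp_all

text \<open>A measurement seen through its two branches. The trace equation is the conservation law
  behind the convergence of the loop series.\<close>

locale quantum_loop =
  fixes E0 E1 :: "'q::finite superop"
  assumes E0: "quantum_operation E0" and E1: "quantum_operation E1"
    and trace_E: "trace (E0 \<rho>) + trace (E1 \<rho>) = trace \<rho>"
begin

lemma quantum_operation_iter:
  assumes "\<And>i. quantum_operation (\<eta> i)"
  shows "quantum_operation (loop_iter E1 \<eta> i)"
proof (induction i)
  case (Suc i)
  have "quantum_operation (\<lambda>\<rho>. \<eta> i (E1 (loop_iter E1 \<eta> i \<rho>)))"
    by (rule quantum_operation_comp[OF assms quantum_operation_comp[OF E1 Suc]])
  then show ?case by (simp add: o_def)
qed (simp add: quantum_operation_id[unfolded id_def] id_def)

text \<open>Bookkeeping of probability: the trace released through the exit plus the trace still in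
  the loop never exceeds the initial trace.\<close>

lemma trace_partial_sum:
  assumes "\<And>i. quantum_operation (\<eta> i)" "psd \<rho>"
  shows "(\<Sum>i<n. Re (trace (E0 (loop_iter E1 \<eta> i \<rho>)))) + Re (trace (loop_iter E1 \<eta> n \<rho>)) \<le> Re (trace \<rho>)"
proof (induction n)
  case (Suc n)
  let ?\<rho> = "loop_iter E1 \<eta> n \<rho>"
  have "psd (E1 ?\<rho>)"
    by (rule quantum_operationD(2)[OF E1 quantum_operationD(2)[OF quantum_operation_iter[OF assms(1)] assms(2)]])
  then have "Re (trace (\<eta> n (E1 ?\<rho>))) \<le> Re (trace (E1 ?\<rho>))"
    by (rule quantum_operationD(3)[OF assms(1)])
  also have "Re (trace (E1 ?\<rho>)) = Re (trace ?\<rho>) - Re (trace (E0 ?\<rho>))"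
    using arg_cong[OF trace_E[of ?\<rho>], of Re] by simp
  finally show ?case
    using Suc by simp
qed simp

lemma trace_summable:
  assumes "\<And>i. quantum_operation (\<eta> i)" "psd \<rho>"
  shows "summable (\<lambda>i. Re (trace (E0 (loop_iter E1 \<eta> i \<rho>))))"
    "(\<Sum>i. Re (trace (E0 (loop_iter E1 \<eta> i \<rho>)))) \<le> Re (trace \<rho>)"
proof -
  have psd: "psd (loop_iter E1 \<eta> i \<rho>)" for i
    by (rule quantum_operationD(2)[OF quantum_operation_iter[OF assms(1)] assms(2)])
  have nonneg: "0 \<le> Re (trace (E0 (loop_iter E1 \<eta> i \<rho>)))" for i
    by (rule psd_trace[OF quantum_operationD(2)[OF E0 psd]])
  have bound: "(\<Sum>i<n. Re (trace (E0 (loop_iter E1 \<eta> i \<rho>)))) \<le> Re (trace \<rho>)" for n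
    using trace_partial_sum[of \<eta>, OF assms, where n=n] psd_trace[OF psd[of n]] by simp
  show summable: "summable (\<lambda>i. Re (trace (E0 (loop_iter E1 \<eta> i \<rho>))))"
    by (rule summableI_nonneg_bounded[OF nonneg bound])
  show "(\<Sum>i. Re (trace (E0 (loop_iter E1 \<eta> i \<rho>)))) \<le> Re (trace \<rho>)"
    by (rule suminf_le_const[OF summable bound])
qed

lemma loop_kraus:
  assumes "\<And>i. quantum_operation (\<eta> i)"
  shows "is_kraus (loop_so E0 E1 \<eta>)" "(\<lambda>i. E0 (loop_iter E1 \<eta> i \<rho>)) sums loop_so E0 E1 \<eta> \<rho>"
proof -
  have kraus: "is_kraus (\<lambda>\<rho>. E0 (loop_iter E1 \<eta> i \<rho>))" for i
    by (rule is_kraus_comp[OF quantum_operationD(1)[OF E0] quantum_operationD(1)[OF quantum_operation_iter[OF assms]]])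
  \<comment> \<open>The trace bound is applied to the identity, the test operator of
    \<open>is_kraus_suminf\<close>.\<close>
  note * = is_kraus_suminf[OF kraus trace_summable(1)[OF assms psd_one]]
  show "is_kraus (loop_so E0 E1 \<eta>)"
    using *(1) by (simp add: loop_so_def[abs_def])
  show "(\<lambda>i. E0 (loop_iter E1 \<eta> i \<rho>)) sums loop_so E0 E1 \<eta> \<rho>"
    unfolding loop_so_def by (rule summable_sums[OF *(2)])
qed

lemma quantum_operation_loop:
  assumes "\<And>i. quantum_operation (\<eta> i)"
  shows "quantum_operation (loop_so E0 E1 \<eta>)"
  unfolding quantum_operation_def
proof (intro conjI allI impI loop_kraus assms)
  fix \<rho> :: "'q oper" assume \<rho>: "psd \<rho>"
  have "(\<lambda>i. Re (trace (E0 (loop_iter E1 \<eta> i \<rho>)))) sums Re (trace (loop_so E0 E1 \<eta> \<rho>))"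
    using sums_trace[OF loop_kraus(2)[of \<eta>, OF assms], of "mat 1" \<rho>] by simp
  then show "Re (trace (loop_so E0 E1 \<eta> \<rho>)) \<le> Re (trace \<rho>)"
    using trace_summable(2)[of \<eta>, OF assms \<rho>] by (simp add: sums_iff)
qed

text \<open>Split off the term of index 0; by \<open>loop_iter_shift\<close> the rest is the series
  of the suffix scheduler, started after one round.\<close>

lemma loop_unfold:
  assumes "\<And>i. quantum_operation (\<eta> i)"
  shows "loop_so E0 E1 \<eta> \<rho> = E0 \<rho> + loop_so E0 E1 (\<lambda>k. \<eta> (Suc k)) (\<eta> 0 (E1 \<rho>))"
proof -
  have "(\<lambda>i. E0 (loop_iter E1 \<eta> (Suc i) \<rho>)) sums loop_so E0 E1 (\<lambda>k. \<eta> (Suc k)) (\<eta> 0 (E1 \<rho>))"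
    unfolding loop_iter_shift by (rule loop_kraus(2)[OF assms])
  then have "(\<lambda>i. E0 (loop_iter E1 \<eta> i \<rho>)) sums (loop_so E0 E1 (\<lambda>k. \<eta> (Suc k)) (\<eta> 0 (E1 \<rho>)) + E0 (loop_iter E1 \<eta> 0 \<rho>))"
    by (rule sums_Suc)
  then show ?thesis
    using sums_unique2[OF loop_kraus(2)[of \<eta>, OF assms]] by (simp add: add.commute)
qed

text \<open>The part of the series from index \<open>i\<close> on, written as a whole loop run on
  the state after \<open>i\<close> rounds. In this form it is visibly a composite of quantum
  operations.\<close>

definition loop_tail :: "(nat \<Rightarrow> 'q superop) \<Rightarrow> nat \<Rightarrow> 'q superop" where
  "loop_tail \<eta> i \<rho> = loop_so E0 E1 (\<lambda>k. \<eta> (i + k)) (loop_iter E1 \<eta> i \<rho>)"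

lemma loop_tail_0: "loop_tail \<eta> 0 = loop_so E0 E1 \<eta>"
  by (rule ext) (simp add: loop_tail_def)

lemma loop_tail_Suc:
  assumes "\<And>i. quantum_operation (\<eta> i)"
  shows "loop_tail \<eta> i \<rho> = E0 (loop_iter E1 \<eta> i \<rho>) + loop_tail \<eta> (Suc i) \<rho>"
  using loop_unfold[of "\<lambda>k. \<eta> (i + k)" "loop_iter E1 \<eta> i \<rho>"] assms by (simp add: loop_tail_def)

text \<open>Dually, this is the third condition on a ranking assertion, with equality.\<close>

lemma loop_tail_shift: "loop_tail (\<lambda>k. \<eta> (Suc k)) i (\<eta> 0 (E1 \<rho>)) = loop_tail \<eta> (Suc i) \<rho>"
  unfolding loop_tail_def loop_iter_shift by simp

lemma quantum_operation_tail:
  assumes "\<And>i. quantum_operation (\<eta> i)"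
  shows "quantum_operation (loop_tail \<eta> i)"
proof -
  have "quantum_operation (\<lambda>\<rho>. loop_so E0 E1 (\<lambda>k. \<eta> (i + k)) (loop_iter E1 \<eta> i \<rho>))"
    by (rule quantum_operation_comp[OF quantum_operation_loop[OF assms] quantum_operation_iter[OF assms]])
  then show ?thesis
    by (simp add: loop_tail_def[abs_def])
qed

text \<open>A tail is the full sum minus a partial sum of a convergent series.\<close>

lemma loop_tail_tendsto_0:
  assumes "\<And>i. quantum_operation (\<eta> i)"
  shows "(\<lambda>i. Re (trace (N ** loop_tail \<eta> i \<rho>))) \<longlonglongrightarrow> 0"
proof -
  let ?f = "\<lambda>i. Re (trace (N ** E0 (loop_iter E1 \<eta> i \<rho>)))"
  have "Re (trace (N ** loop_tail \<eta> i \<rho>)) = Re (trace (N ** loop_so E0 E1 \<eta> \<rho>)) - (\<Sum>k<i. ?f k)" for i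
  proof (induction i)
    case (Suc i)
    then show ?case
      using loop_tail_Suc[of \<eta>, OF assms, of i \<rho>] by (simp add: matrix_add_ldistrib trace_add)
  qed (simp add: loop_tail_0)
  moreover have "(\<lambda>i. Re (trace (N ** loop_so E0 E1 \<eta> \<rho>)) - (\<Sum>k<i. ?f k)) \<longlonglongrightarrow> 0"
    using sums_trace[OF loop_kraus(2)[of \<eta>, OF assms], of N \<rho>] unfolding sums_def
    by (intro tendsto_eq_intros) auto
  ultimately show ?thesis by simp
qed

end

lemma quantum_loop_proj_so:
  "distinct qs \<Longrightarrow> reg_proj_meas (length qs) P0 P1 \<Longrightarrow> quantum_loop (proj_so qs P0) (proj_so qs P1)"
  by unfold_locales (simp_all add: proj_so_measurement)

text \<open>Brings the loop semantics into the form studied in \<open>quantum_loop\<close>.\<close>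

lemma sem_While:
  "sem (While qs P0 P1 S) = {loop_so (proj_so qs P0) (proj_so qs P1) \<eta> | \<eta>. \<forall>i. \<eta> i \<in> sem S}"
  by (simp add: loop_so_def[abs_def])

lemma quantum_operation_sem: "wf_prog S \<Longrightarrow> \<E> \<in> sem S \<Longrightarrow> quantum_operation \<E>"
proof (induction S arbitrary: \<E>)
  case Skip
  then show ?case by (simp add: quantum_operation_id[unfolded id_def] id_def)
next
  case Abort
  then show ?case by (simp add: quantum_operation_zero)
next
  case (Init qs)
  then show ?case by (simp add: quantum_operation_set0)
next
  case (Unit qs U)
  then show ?case by (simp add: quantum_operation_unitary)
next
  case (Seq S0 S1)
  then obtain E F where "\<E> = F \<circ> E" "quantum_operation E" "quantum_operation F"
    by auto
  then show ?case
    using quantum_operation_comp[of F E] by (simp add: o_def)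
next
  case (NDet S0 S1)
  then show ?case by auto
next
  case (Cond qs P0 P1 S1 S0)
  then obtain F0 F1 where \<E>: "\<E> = (\<lambda>\<rho>. F0 (proj_so qs P0 \<rho>) + F1 (proj_so qs P1 \<rho>))"
    and F: "quantum_operation F0" "quantum_operation F1"
    by auto
  have meas: "distinct qs" "reg_proj_meas (length qs) P0 P1"
    using Cond.prems by simp_all
  note P = proj_so_measurement[OF meas]
  note FP = quantum_operation_comp[OF F(1) P(1)] quantum_operation_comp[OF F(2) P(2)]
  show ?case
    unfolding quantum_operation_def
  proof (intro conjI allI impI)
    show "is_kraus \<E>"
      unfolding \<E> by (rule is_kraus_add[OF quantum_operationD(1)[OF FP(1)] quantum_operationD(1)[OF FP(2)]])
    fix \<rho> :: "'a oper" assume \<rho>: "psd \<rho>"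
    have "Re (trace (F0 (proj_so qs P0 \<rho>))) \<le> Re (trace (proj_so qs P0 \<rho>))"
      by (rule quantum_operationD(3)[OF F(1) quantum_operationD(2)[OF P(1) \<rho>]])
    moreover have "Re (trace (F1 (proj_so qs P1 \<rho>))) \<le> Re (trace (proj_so qs P1 \<rho>))"
      by (rule quantum_operationD(3)[OF F(2) quantum_operationD(2)[OF P(2) \<rho>]])
    ultimately show "Re (trace (\<E> \<rho>)) \<le> Re (trace \<rho>)"
      using arg_cong[OF P(3)[of \<rho>], of Re] by (simp add: \<E> trace_add)
  qed
next
  case (While qs P0 P1 S)
  then obtain \<eta> where \<E>: "\<E> = loop_so (proj_so qs P0) (proj_so qs P1) \<eta>" and "\<And>i. \<eta> i \<in> sem S"
    unfolding sem_While by blast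
  then have \<eta>: "\<And>i. quantum_operation (\<eta> i)"
    using While by simp
  have "quantum_loop (proj_so qs P0) (proj_so qs P1)"
    using While.prems by (simp add: quantum_loop_proj_so)
  then show ?case
    unfolding \<E> by (rule quantum_loop.quantum_operation_loop[OF _ \<eta>])
qed

section \<open>Soundness\<close>

lemma psd_limit:
  fixes X :: "nat \<Rightarrow> 'q::finite oper"
  assumes lim: "X \<longlonglongrightarrow> L" and psd: "\<And>n. psd (X n)"
  shows "psd L"
proof (rule psdI_trace)
  have "(\<lambda>n. dagger (X n)) \<longlonglongrightarrow> dagger L"
    unfolding dagger_def by (intro vec_tendstoI) (simp add: tendsto_cnj tendsto_vec_nth lim)
  then have "X \<longlonglongrightarrow> dagger L"
    unfolding psd_dagger[OF psd] .
  then show "dagger L = L"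
    using lim by (rule LIMSEQ_unique)
  fix \<rho> :: "'q oper" assume \<rho>: "psd \<rho>"
  show "0 \<le> Re (trace (L ** \<rho>))"
    using tendsto_trace[OF lim, of \<rho>] psd_trace_nonneg[OF \<rho> psd]
    by (simp add: trace_mul_sym[of L] LIMSEQ_le_const)
qed

text \<open>Traces decrease and are bounded below, and the norm of a positive difference is bounded
  by a multiple of its trace, so the sequence is Cauchy. Its limit \<open>L\<close> is positive and
  a lower bound, hence \<open>L \<sqsubseteq>\<^sub>L 0\<close> by \<open>inf\<close>, and its trace
  against \<rho> vanishes.\<close>

lemma decreasing_psd_tendsto_0:
  fixes A :: "nat \<Rightarrow> 'q::finite oper"
  assumes psd: "\<And>i. psd (A i)" and dec: "\<And>i. A (Suc i) \<sqsubseteq>\<^sub>L A i"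
    and inf: "\<And>B. (\<And>i. B \<sqsubseteq>\<^sub>L A i) \<Longrightarrow> B \<sqsubseteq>\<^sub>L 0" and \<rho>: "psd \<rho>"
  shows "(\<lambda>i. Re (trace (A i ** \<rho>))) \<longlonglongrightarrow> 0"
proof -
  have diff: "psd (A m - A (m + k))" for m k
  proof (induction k)
    case (Suc k)
    then show ?case
      using psd_add[of "A m - A (m + k)" "A (m + k) - A (Suc (m + k))"] dec[of "m + k"]
      by (simp add: lowner_le_def)
  qed simp
  define t where "t i = Re (trace (A i))" for i
  have t_diff: "Re (trace (A m - A (m + k))) = t m - t (m + k)" for m k
    by (simp add: t_def trace_sub)
  have "decseq t"
    using psd_trace[OF diff[of _ 1]] unfolding t_diff by (simp add: decseq_Suc_iff)
  moreover have "0 \<le> t i" for i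
    unfolding t_def by (rule psd_trace[OF psd])
  ultimately have "convergent t"
    using decseq_convergent[of t 0] convergentI by metis
  then have "Cauchy t"
    by (rule convergent_Cauchy)
  define c where "c = real (CARD('q \<Rightarrow> bool) ^ 2)"
  have c: "c > 0" by (simp add: c_def)
  have norm: "norm (A m - A (m + k)) \<le> c * (t m - t (m + k))" for m k
    using psd_norm_le[OF diff[of m k]] unfolding t_diff c_def .
  have "Cauchy A"
  proof (rule CauchyI')
    fix e :: real assume "e > 0"
    then have "e / c > 0" using c by simp
    then obtain M where M: "\<And>m n. m \<ge> M \<Longrightarrow> n \<ge> M \<Longrightarrow> norm (t m - t n) < e / c"
      using CauchyD[OF \<open>Cauchy t\<close>] by blast
    have "norm (A m - A n) < e" if "m \<ge> M" "n > m" for m n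
    proof -
      obtain k where k: "n = m + k"
        using \<open>n > m\<close> less_imp_add_positive by blast
      have "t m - t n < e / c"
        using M[of m n] that by simp
      then have "c * (t m - t n) < e"
        using c by (simp add: field_simps)
      then show ?thesis
        using norm[of m k] k by simp
    qed
    then show "\<exists>M. \<forall>m\<ge>M. \<forall>n>m. dist (A m) (A n) < e"
      unfolding dist_norm by blast
  qed
  then obtain L where L: "A \<longlonglongrightarrow> L"
    using Cauchy_convergent convergent_def by blast
  have L_le: "L \<sqsubseteq>\<^sub>L A i" for i
  proof -
    have "(\<lambda>k. A (i + k)) \<longlonglongrightarrow> L"
      using LIMSEQ_ignore_initial_segment[OF L, of i] by (simp add: add.commute)
    then have "(\<lambda>k. A i - A (i + k)) \<longlonglongrightarrow> A i - L"
      by (intro tendsto_intros)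
    then show ?thesis
      unfolding lowner_le_def using diff by (rule psd_limit)
  qed
  have "L \<sqsubseteq>\<^sub>L 0"
    using L_le by (rule inf)
  then have "Re (trace (L ** \<rho>)) \<le> 0"
    using \<rho> unfolding lowner_le_trace by auto
  moreover have "0 \<le> Re (trace (L ** \<rho>))"
    by (rule psd_trace_nonneg[OF psd_limit[OF L psd] \<rho>])
  ultimately have "Re (trace (\<rho> ** L)) = 0"
    by (simp add: trace_mul_sym[of \<rho>])
  then show ?thesis
    using tendsto_trace[OF L, of \<rho>] by (simp add: trace_mul_sym[of \<rho>])
qed

section \<open>Expectations over assertions\<close>

lemma valid_tot_iff:
  "valid_tot \<Theta> S \<Psi> \<longleftrightarrow> (\<forall>\<rho>. partial_density \<rho> \<longrightarrow>
    (\<forall>\<E>\<in>sem S. \<forall>N\<in>\<Psi>. Exp \<rho> \<Theta> \<le> ereal (Re (trace (N ** \<E> \<rho>)))))"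
  unfolding valid_tot_def Exp_def[of _ \<Psi>] by (auto simp: le_INF_iff)

lemma le_inf_iff:
  "le_inf \<Theta> \<Psi> \<longleftrightarrow> (\<forall>\<rho>. partial_density \<rho> \<longrightarrow> (\<forall>N\<in>\<Psi>. Exp \<rho> \<Theta> \<le> ereal (Re (trace (N ** \<rho>)))))"
  unfolding le_inf_def Exp_def[of _ \<Psi>] by (simp add: le_INF_iff)

lemma le_inf_superset: "\<Psi> \<subseteq> \<Theta> \<Longrightarrow> le_inf \<Theta> \<Psi>"
  unfolding le_inf_def Exp_def by (simp add: INF_superset_mono)

lemma Exp_lower: "M \<in> \<Theta> \<Longrightarrow> Exp \<rho> \<Theta> \<le> ereal (Re (trace (M ** \<rho>)))"
  unfolding Exp_def by (rule INF_lower)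

lemma valid_tot_Exp:
  "valid_tot \<Theta> S \<Psi> \<Longrightarrow> partial_density \<rho> \<Longrightarrow> \<E> \<in> sem S \<Longrightarrow> Exp \<rho> \<Theta> \<le> Exp (\<E> \<rho>) \<Psi>"
  unfolding valid_tot_def by (auto simp: le_INF_iff)

text \<open>The infimum need not be attained, which costs an arbitrarily small
  \<open>e\<close>.\<close>

lemma Exp_lessD:
  assumes "Exp \<rho> \<Theta> \<le> ereal a" "e > 0"
  obtains M where "M \<in> \<Theta>" "Re (trace (M ** \<rho>)) < a + e"
proof -
  have "Exp \<rho> \<Theta> < ereal (a + e)"
    using assms by (simp add: le_less_trans[OF assms(1)])
  then show thesis
    using that unfolding Exp_def by (auto simp: INF_less_iff)
qed

text \<open>The two predicates in \<open>meas_pre\<close> are chosen independently, so nearly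
  optimal choices for the branches, each with slack \<open>e / 2\<close>, combine into one
  predicate. The real bounds \<open>a\<close> and \<open>b\<close> exclude empty assertions, whose
  expectation is infinite.\<close>

lemma Exp_meas_pre_le:
  assumes "Exp (proj_so qs P0 \<rho>) \<Theta>0 \<le> ereal a" "Exp (proj_so qs P1 \<rho>) \<Theta>1 \<le> ereal b"
  shows "Exp \<rho> (meas_pre qs P0 P1 \<Theta>0 \<Theta>1) \<le> ereal (a + b)"
proof (rule ereal_le_epsilon2)
  fix e :: real assume "e > 0"
  then have e: "e / 2 > 0" by simp
  obtain M0 where M0: "M0 \<in> \<Theta>0" "Re (trace (M0 ** proj_so qs P0 \<rho>)) < a + e / 2"
    using Exp_lessD[OF assms(1) e] .
  obtain M1 where M1: "M1 \<in> \<Theta>1" "Re (trace (M1 ** proj_so qs P1 \<rho>)) < b + e / 2"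
    using Exp_lessD[OF assms(2) e] .
  let ?M = "proj_so qs P0 M0 + proj_so qs P1 M1"
  have "?M \<in> meas_pre qs P0 P1 \<Theta>0 \<Theta>1"
    unfolding meas_pre_def using M0(1) M1(1) by blast
  then have "Exp \<rho> (meas_pre qs P0 P1 \<Theta>0 \<Theta>1) \<le> ereal (Re (trace (?M ** \<rho>)))"
    by (rule Exp_lower)
  also have "Re (trace (?M ** \<rho>)) \<le> a + b + e"
    using M0(2) M1(2) by (simp add: oper_mult_add_left trace_add trace_proj_so_adjoint)
  finally show "Exp \<rho> (meas_pre qs P0 P1 \<Theta>0 \<Theta>1) \<le> ereal (a + b) + ereal e"
    by simp
qed

lemma quantum_predicate_zero: "quantum_predicate 0"
  by (rule quantum_predicateI) (simp_all add: psd_trace)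

lemma init_pre_adjoint: "distinct qs \<Longrightarrow> superop_adjoint (set0_so qs) M = init_pre qs M"
  by (rule superop_adjointI[OF quantum_operationD(1)[OF quantum_operation_set0]]) (simp_all add: trace_init_pre)

lemma trace_conj_by_adjoint: "trace ((dagger A ** M ** A) ** \<rho>) = trace (M ** conj_by A \<rho>)"
  by (simp add: conj_by_def trace_mult_cycle)

lemma unitary_adjoint:
  assumes "distinct qs" "reg_unitary (length qs) U"
  shows "superop_adjoint (conj_by (lift_op qs U)) M = dagger (lift_op qs U) ** M ** lift_op qs U"
  by (rule superop_adjointI[OF quantum_operationD(1)[OF quantum_operation_unitary[OF assms]] trace_conj_by_adjoint])

text \<open>The traces of the two branches sum to the original one, which keeps the sum of the
  measured predicates below the identity.\<close>

lemma assertion_meas_pre: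
  assumes meas: "distinct qs" "reg_proj_meas (length qs) P0 P1" and "assertion \<Theta>0" "assertion \<Theta>1"
  shows "assertion (meas_pre qs P0 P1 \<Theta>0 \<Theta>1)"
  unfolding assertion_def
proof
  note P = proj_so_measurement[OF meas]
  fix M assume "M \<in> meas_pre qs P0 P1 \<Theta>0 \<Theta>1"
  then obtain M0 M1 where M: "M = proj_so qs P0 M0 + proj_so qs P1 M1" "quantum_predicate M0" "quantum_predicate M1"
    using assms(3,4) by (auto simp: meas_pre_def assertion_def)
  show "quantum_predicate M"
  proof (rule quantum_predicateI)
    show "psd M"
      unfolding M(1) by (rule psd_add[OF quantum_operationD(2)[OF P(1) quantum_predicateD(1)[OF M(2)]]
        quantum_operationD(2)[OF P(2) quantum_predicateD(1)[OF M(3)]]])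
    fix \<rho> :: "'a oper" assume \<rho>: "psd \<rho>"
    have "Re (trace (M0 ** proj_so qs P0 \<rho>)) \<le> Re (trace (proj_so qs P0 \<rho>))"
      by (rule quantum_predicateD(4)[OF M(2) quantum_operationD(2)[OF P(1) \<rho>]])
    moreover have "Re (trace (M1 ** proj_so qs P1 \<rho>)) \<le> Re (trace (proj_so qs P1 \<rho>))"
      by (rule quantum_predicateD(4)[OF M(3) quantum_operationD(2)[OF P(2) \<rho>]])
    ultimately show "Re (trace (M ** \<rho>)) \<le> Re (trace \<rho>)"
      using arg_cong[OF P(3)[of \<rho>], of Re]
      by (simp add: M(1) oper_mult_add_left trace_add trace_proj_so_adjoint)
  qed
qed

lemma ranking_assertionD:
  assumes "ranking_assertion \<Theta> qs P1 S R" "\<And>i. \<eta> i \<in> sem S"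
  shows "psd (R \<eta> i)" "le_inf \<Theta> {R \<eta> 0}" "R \<eta> (Suc i) \<sqsubseteq>\<^sub>L R \<eta> i"
    "(\<And>i. A \<sqsubseteq>\<^sub>L R \<eta> i) \<Longrightarrow> A \<sqsubseteq>\<^sub>L 0"
    "proj_so qs P1 (superop_adjoint (\<eta> 0) (R (\<lambda>k. \<eta> (Suc k)) i)) \<sqsubseteq>\<^sub>L R \<eta> (Suc i)"
  using assms unfolding ranking_assertion_def by (blast intro: quantum_predicateD(1))+

text \<open>After \<open>n\<close> rounds the unfinished part is bounded by ranking predicate 0 of
  the suffix scheduler. The third ranking condition, used \<open>n\<close> times, carries this bound
  back to \<open>R \<eta> n\<close> at the initial state.\<close>

lemma valid_tot_While:
  fixes \<Theta> \<Psi> :: "'q::finite oper set"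
  assumes wf: "wf_prog (While qs P0 P1 S)"
    and body: "valid_tot \<Theta> S (meas_pre qs P0 P1 \<Psi> \<Theta>)"
    and ranking: "ranking_assertion (meas_pre qs P0 P1 \<Psi> \<Theta>) qs P1 S R"
  shows "valid_tot (meas_pre qs P0 P1 \<Psi> \<Theta>) (While qs P0 P1 S) \<Psi>"
  unfolding valid_tot_iff sem_While
proof (intro allI impI ballI)
  let ?Inv = "meas_pre qs P0 P1 \<Psi> \<Theta>"
  let ?E0 = "proj_so qs P0 :: 'q superop" and ?E1 = "proj_so qs P1 :: 'q superop"
  have "distinct qs" "reg_proj_meas (length qs) P0 P1" and wf_S: "wf_prog S"
    using wf by simp_all
  then interpret quantum_loop ?E0 ?E1
    by (simp add: quantum_loop_proj_so)
  fix \<rho> N :: "'q oper" and \<E>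
  assume \<rho>: "partial_density \<rho>" and N: "N \<in> \<Psi>"
    and "\<E> \<in> {loop_so ?E0 ?E1 \<eta> | \<eta>. \<forall>i. \<eta> i \<in> sem S}"
  then obtain \<eta> where \<E>: "\<E> = loop_so ?E0 ?E1 \<eta>" and \<eta>: "\<And>i. \<eta> i \<in> sem S"
    by blast
  have op: "quantum_operation (\<eta> i)" for i
    by (rule quantum_operation_sem[OF wf_S \<eta>])
  define \<sigma> where "\<sigma> i = loop_iter ?E1 \<eta> i \<rho>" for i
  have \<sigma>_0: "\<sigma> 0 = \<rho>" and \<sigma>_Suc: "\<sigma> (Suc i) = \<eta> i (?E1 (\<sigma> i))" for i
    by (simp_all add: \<sigma>_def)
  have \<sigma>: "partial_density (\<sigma> i)" for i
    unfolding \<sigma>_def by (rule quantum_operationD(4)[OF quantum_operation_iter[OF op] \<rho>])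
  define a where "a i = Re (trace (N ** ?E0 (\<sigma> i)))" for i
  \<comment> \<open>The bound \<open>b\<close> stays general, since each induction step replaces it
    by \<open>a n + b\<close>.\<close>
  have step: "Exp \<rho> ?Inv \<le> ereal ((\<Sum>i<n. a i) + b)" if "Exp (\<sigma> n) ?Inv \<le> ereal b" for n b
    using that
  proof (induction n arbitrary: b)
    case 0
    then show ?case by (simp add: \<sigma>_0)
  next
    case (Suc n)
    have "Exp (?E1 (\<sigma> n)) \<Theta> \<le> Exp (\<sigma> (Suc n)) ?Inv"
      unfolding \<sigma>_Suc by (rule valid_tot_Exp[OF body quantum_operationD(4)[OF E1 \<sigma>] \<eta>])
    also note Suc.prems
    finally have "Exp (\<sigma> n) ?Inv \<le> ereal (a n + b)"
      unfolding a_def by (intro Exp_meas_pre_le Exp_lower N)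
    from Suc.IH[OF this] show ?case
      by (simp add: add.assoc)
  qed
  \<comment> \<open>Each round on the state is traded for one step of the ranking index;
    \<open>m\<close> is arbitrary because it grows as rounds are moved.\<close>
  have rank: "Re (trace (R (\<lambda>k. \<eta> (n + k)) m ** \<sigma> n)) \<le> Re (trace (R \<eta> (m + n) ** \<rho>))" for n m
  proof (induction n arbitrary: m)
    case (Suc n)
    let ?R = "superop_adjoint (\<eta> n) (R (\<lambda>k. \<eta> (Suc n + k)) m)"
    have psd: "psd (\<sigma> n)"
      using \<sigma> by (simp add: partial_density_def)
    have "Re (trace (R (\<lambda>k. \<eta> (Suc n + k)) m ** \<sigma> (Suc n))) = Re (trace (?E1 ?R ** \<sigma> n))"
      by (simp add: \<sigma>_Suc trace_superop_adjoint[OF quantum_operationD(1)[OF op]] trace_proj_so_adjoint)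
    also have "\<dots> \<le> Re (trace (R (\<lambda>k. \<eta> (n + k)) (Suc m) ** \<sigma> n))"
      using ranking_assertionD(5)[OF ranking, of "\<lambda>k. \<eta> (n + k)" m] \<eta> psd
      unfolding lowner_le_trace by simp
    also have "\<dots> \<le> Re (trace (R \<eta> (Suc m + n) ** \<rho>))"
      by (rule Suc.IH)
    finally show ?case by simp
  qed (simp add: \<sigma>_0)
  have bound: "Exp \<rho> ?Inv \<le> ereal ((\<Sum>i<n. a i) + Re (trace (R \<eta> n ** \<rho>)))" for n
  proof (rule step)
    have "Exp (\<sigma> n) ?Inv \<le> ereal (Re (trace (R (\<lambda>k. \<eta> (n + k)) 0 ** \<sigma> n)))"
      using ranking_assertionD(2)[OF ranking, of "\<lambda>k. \<eta> (n + k)"] \<eta> \<sigma> by (simp add: le_inf_iff)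
    also have "\<dots> \<le> ereal (Re (trace (R \<eta> n ** \<rho>)))"
      using rank[of n 0] by simp
    finally show "Exp (\<sigma> n) ?Inv \<le> ereal (Re (trace (R \<eta> n ** \<rho>)))" .
  qed
  have "psd \<rho>"
    using \<rho> by (simp add: partial_density_def)
  have "(\<lambda>n. Re (trace (R \<eta> n ** \<rho>))) \<longlonglongrightarrow> 0"
  proof (rule decreasing_psd_tendsto_0)
    show "psd (R \<eta> i)" "R \<eta> (Suc i) \<sqsubseteq>\<^sub>L R \<eta> i" for i
      using ranking_assertionD(1,3)[where \<eta> = \<eta>, OF ranking \<eta>] by blast+
    show "A \<sqsubseteq>\<^sub>L 0" if "\<And>i. A \<sqsubseteq>\<^sub>L R \<eta> i" for A
      using ranking_assertionD(4)[where \<eta> = \<eta>, OF ranking \<eta>] that by blast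
  qed fact
  moreover have "(\<lambda>n. \<Sum>i<n. a i) \<longlonglongrightarrow> Re (trace (N ** \<E> \<rho>))"
    unfolding a_def \<sigma>_def \<E> using sums_trace[OF loop_kraus(2)[of \<eta>, OF op]] unfolding sums_def .
  ultimately have "(\<lambda>n. (\<Sum>i<n. a i) + Re (trace (R \<eta> n ** \<rho>))) \<longlonglongrightarrow> Re (trace (N ** \<E> \<rho>))"
    using tendsto_add by fastforce
  then have "(\<lambda>n. ereal ((\<Sum>i<n. a i) + Re (trace (R \<eta> n ** \<rho>)))) \<longlonglongrightarrow> ereal (Re (trace (N ** \<E> \<rho>)))"
    by (rule tendsto_ereal)
  then show "Exp \<rho> ?Inv \<le> ereal (Re (trace (N ** \<E> \<rho>)))"
    using LIMSEQ_le_const bound by blast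
qed

text \<open>Induction on the derivation, not on the program, because (Imp) and (Union) leave the
  program unchanged.\<close>

lemma derivable_sound:
  assumes "derivable \<Theta> S \<Psi>" "wf_prog S"
  shows "assertion \<Theta> \<and> assertion \<Psi> \<and> valid_tot \<Theta> S \<Psi>"
  using assms
proof (induction rule: derivable.induct)
  case (Skip \<Theta>)
  then show ?case
    by (auto simp: valid_tot_iff intro: Exp_lower)
next
  case AbortT
  show ?case
    by (auto simp: valid_tot_iff assertion_def quantum_predicate_zero Exp_def)
next
  case (Init \<Theta> qs)
  then have qs: "distinct qs" by simp
  have "quantum_predicate (init_pre qs M)" if "M \<in> \<Theta>" for M
    using quantum_predicate_adjoint[OF quantum_operation_set0[OF qs], of M] that Init.hyps
    by (simp add: init_pre_adjoint[OF qs] assertion_def)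
  moreover have "Exp \<rho> (init_pre qs ` \<Theta>) \<le> ereal (Re (trace (M ** set0_so qs \<rho>)))" if "M \<in> \<Theta>" for \<rho> M
    using Exp_lower[of "init_pre qs M" "init_pre qs ` \<Theta>" \<rho>] that by (simp add: trace_init_pre)
  ultimately show ?case
    using Init.hyps by (auto simp: assertion_def valid_tot_iff)
next
  case (Unit \<Theta> qs U)
  then have U: "distinct qs" "reg_unitary (length qs) U" by simp_all
  let ?f = "\<lambda>M. dagger (lift_op qs U) ** M ** lift_op qs U"
  have "quantum_predicate (?f M)" if "M \<in> \<Theta>" for M
    using quantum_predicate_adjoint[OF quantum_operation_unitary[OF U], of M] that Unit.hyps
    by (simp add: unitary_adjoint[OF U] assertion_def)
  moreover have "Exp \<rho> (?f ` \<Theta>) \<le> ereal (Re (trace (M ** conj_by (lift_op qs U) \<rho>)))" if "M \<in> \<Theta>" for \<rho> M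
    using Exp_lower[of "?f M" "?f ` \<Theta>" \<rho>] that by (simp add: trace_conj_by_adjoint)
  ultimately show ?case
    using Unit.hyps by (auto simp: assertion_def valid_tot_iff)
next
  case (Seq \<Theta> S0 \<Theta>' S1 \<Psi>)
  then have IH: "valid_tot \<Theta> S0 \<Theta>'" "valid_tot \<Theta>' S1 \<Psi>" and wf: "wf_prog S0"
    by simp_all
  have "Exp \<rho> \<Theta> \<le> ereal (Re (trace (N ** F (E \<rho>))))"
    if "partial_density \<rho>" "E \<in> sem S0" "F \<in> sem S1" "N \<in> \<Psi>" for \<rho> E F N
  proof -
    have "Exp \<rho> \<Theta> \<le> Exp (E \<rho>) \<Theta>'"
      by (rule valid_tot_Exp[OF IH(1) that(1,2)])
    also have "\<dots> \<le> Exp (F (E \<rho>)) \<Psi>"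
      by (rule valid_tot_Exp[OF IH(2) quantum_operationD(4)[OF quantum_operation_sem[OF wf that(2)] that(1)] that(3)])
    also have "\<dots> \<le> ereal (Re (trace (N ** F (E \<rho>))))"
      by (rule Exp_lower[OF that(4)])
    finally show ?thesis .
  qed
  then show ?case
    using Seq by (auto simp: valid_tot_iff)
next
  case (NDet \<Theta> S0 \<Psi> S1)
  then show ?case
    by (auto simp: valid_tot_iff)
next
  case (Meas \<Theta>1 S1 \<Psi> \<Theta>0 S0 qs P0 P1)
  then have IH: "valid_tot \<Theta>1 S1 \<Psi>" "valid_tot \<Theta>0 S0 \<Psi>" "assertion \<Theta>1" "assertion \<Theta>0" "assertion \<Psi>"
    and meas: "distinct qs" "reg_proj_meas (length qs) P0 P1"
    by simp_all
  note P = proj_so_measurement[OF meas]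
  have "Exp \<rho> (meas_pre qs P0 P1 \<Theta>0 \<Theta>1) \<le> ereal (Re (trace (N ** (E0 (proj_so qs P0 \<rho>) + E1 (proj_so qs P1 \<rho>)))))"
    if "partial_density \<rho>" "E0 \<in> sem S0" "E1 \<in> sem S1" "N \<in> \<Psi>" for \<rho> E0 E1 N
  proof -
    have "Exp (proj_so qs P0 \<rho>) \<Theta>0 \<le> ereal (Re (trace (N ** E0 (proj_so qs P0 \<rho>))))"
      using IH(2) quantum_operationD(4)[OF P(1) that(1)] that unfolding valid_tot_iff by blast
    moreover have "Exp (proj_so qs P1 \<rho>) \<Theta>1 \<le> ereal (Re (trace (N ** E1 (proj_so qs P1 \<rho>))))"
      using IH(1) quantum_operationD(4)[OF P(2) that(1)] that unfolding valid_tot_iff by blast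
    ultimately show ?thesis
      unfolding matrix_add_ldistrib trace_add plus_complex.sel by (rule Exp_meas_pre_le)
  qed
  then show ?case
    using IH assertion_meas_pre[OF meas IH(4,3)] by (auto simp: valid_tot_iff)
next
  case (WhileT \<Psi> \<Theta> S qs P0 P1)
  then have meas: "distinct qs" "reg_proj_meas (length qs) P0 P1" and IH: "assertion \<Theta>" "valid_tot \<Theta> S (meas_pre qs P0 P1 \<Psi> \<Theta>)"
    by simp_all
  obtain R where R: "ranking_assertion (meas_pre qs P0 P1 \<Psi> \<Theta>) qs P1 S R"
    using WhileT.hyps by blast
  show ?case
    using valid_tot_While[OF WhileT.prems IH(2) R] assertion_meas_pre[OF meas WhileT.hyps(1) IH(1)] WhileT.hyps(1)
    by blast
next
  case (Imp \<Theta> \<Psi> \<Theta>' S \<Psi>')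
  have "Exp \<rho> \<Theta> \<le> ereal (Re (trace (N ** \<E> \<rho>)))" if "partial_density \<rho>" "\<E> \<in> sem S" "N \<in> \<Psi>" for \<rho> \<E> N
  proof -
    have "Exp \<rho> \<Theta> \<le> Exp \<rho> \<Theta>'"
      using Imp.hyps(3) that(1) by (simp add: le_inf_def)
    also have "\<dots> \<le> Exp (\<E> \<rho>) \<Psi>'"
      using Imp.IH[OF Imp.prems] that by (intro valid_tot_Exp[of _ S]) simp_all
    \<comment> \<open>The final state is again a partial density operator, so \<open>le_inf\<close>
      applies to it.\<close>
    also have "\<dots> \<le> Exp (\<E> \<rho>) \<Psi>"
      using Imp.hyps(5) quantum_operationD(4)[OF quantum_operation_sem[OF Imp.prems that(2)] that(1)]
      by (simp add: le_inf_def)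
    also have "\<dots> \<le> ereal (Re (trace (N ** \<E> \<rho>)))"
      by (rule Exp_lower[OF that(3)])
    finally show ?thesis .
  qed
  then show ?case
    using Imp.hyps by (simp add: valid_tot_iff)
next
  case (Union C S)
  then have IH: "assertion \<Theta>" "assertion \<Psi>" "valid_tot \<Theta> S \<Psi>" if "(\<Theta>, \<Psi>) \<in> C" for \<Theta> \<Psi>
    using that by blast+
  have "Exp \<rho> (\<Union>(\<Theta>, \<Psi>)\<in>C. \<Theta>) \<le> ereal (Re (trace (N ** \<E> \<rho>)))"
    if "partial_density \<rho>" "\<E> \<in> sem S" "(\<Theta>, \<Psi>) \<in> C" "N \<in> \<Psi>" for \<rho> \<E> N \<Theta> \<Psi>
  proof -
    \<comment> \<open>A larger set has a smaller infimum, so the pair whose postcondition contains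
      \<open>N\<close> suffices.\<close>
    have "Exp \<rho> (\<Union>(\<Theta>, \<Psi>)\<in>C. \<Theta>) \<le> Exp \<rho> \<Theta>"
      unfolding Exp_def using that(3) by (intro INF_superset_mono) auto
    also have "\<dots> \<le> ereal (Re (trace (N ** \<E> \<rho>)))"
      using IH(3)[OF that(3)] that unfolding valid_tot_iff by blast
    finally show ?thesis .
  qed
  then have "valid_tot (\<Union>(\<Theta>, \<Psi>)\<in>C. \<Theta>) S (\<Union>(\<Theta>, \<Psi>)\<in>C. \<Psi>)"
    unfolding valid_tot_iff by fast
  then show ?case
    using IH(1,2) unfolding assertion_def by fast
qed

section \<open>Completeness\<close>

definition wp :: "'q::finite prog \<Rightarrow> 'q oper set \<Rightarrow> 'q oper set" where
  "wp S \<Psi> = {superop_adjoint \<E> N | \<E> N. \<E> \<in> sem S \<and> N \<in> \<Psi>}"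

text \<open>Trace duality moves each super-operator from the state to the predicate.\<close>

lemma valid_tot_iff_wp:
  assumes "wf_prog S"
  shows "valid_tot \<Theta> S \<Psi> \<longleftrightarrow> le_inf \<Theta> (wp S \<Psi>)"
proof -
  have "trace (superop_adjoint \<E> N ** \<rho>) = trace (N ** \<E> \<rho>)" if "\<E> \<in> sem S" for \<E> N \<rho>
    by (rule trace_superop_adjoint[OF quantum_operationD(1)[OF quantum_operation_sem[OF assms that]]])
  then show ?thesis
    unfolding valid_tot_iff le_inf_iff wp_def by fastforce
qed

lemma assertion_wp: "wf_prog S \<Longrightarrow> assertion \<Psi> \<Longrightarrow> assertion (wp S \<Psi>)"
  using quantum_predicate_adjoint quantum_operation_sem unfolding assertion_def wp_def by blast

text \<open>\<open>wp\<close> is a union over the elements of the postcondition, so the pairs for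
  single \<open>N\<close> form a family for (Union).\<close>

lemma derivable_wp_singletons:
  assumes "\<And>N. N \<in> \<Psi> \<Longrightarrow> derivable (wp S {N}) S {N}"
  shows "derivable (wp S \<Psi>) S \<Psi>"
proof -
  have "derivable (\<Union>(\<Theta>, \<Psi>)\<in>(\<lambda>N. (wp S {N}, {N})) ` \<Psi>. \<Theta>) S (\<Union>(\<Theta>, \<Psi>)\<in>(\<lambda>N. (wp S {N}, {N})) ` \<Psi>. \<Psi>)"
    using assms by (intro derivable.Union) auto
  moreover have "(\<Union>(\<Theta>, \<Psi>)\<in>(\<lambda>N. (wp S {N}, {N})) ` \<Psi>. \<Theta>) = wp S \<Psi>"
    by (auto simp: wp_def)
  ultimately show ?thesis by simp
qed

text \<open>Dual of \<open>loop_unfold\<close> for self-dual branches. Adjoints reverse the order of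
  composition, so the first round becomes the outermost map.\<close>

lemma (in quantum_loop) loop_adjoint_unfold:
  assumes E0_adj: "\<And>M \<rho>. trace (E0 M ** \<rho>) = trace (M ** E0 \<rho>)"
    and E1_adj: "\<And>M \<rho>. trace (E1 M ** \<rho>) = trace (M ** E1 \<rho>)"
    and \<eta>: "\<And>i. quantum_operation (\<eta> i)"
  shows "superop_adjoint (loop_so E0 E1 \<eta>) N =
    E0 N + E1 (superop_adjoint (\<eta> 0) (superop_adjoint (loop_so E0 E1 (\<lambda>k. \<eta> (Suc k))) N))"
proof (rule superop_adjointI)
  show "is_kraus (loop_so E0 E1 \<eta>)"
    by (rule loop_kraus(1)[OF \<eta>])
  have "is_kraus (loop_so E0 E1 (\<lambda>k. \<eta> (Suc k)))"
    by (rule loop_kraus(1)[OF \<eta>])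
  then show "trace ((E0 N + E1 (superop_adjoint (\<eta> 0) (superop_adjoint (loop_so E0 E1 (\<lambda>k. \<eta> (Suc k))) N))) ** \<rho>) =
      trace (N ** loop_so E0 E1 \<eta> \<rho>)" for \<rho>
    unfolding loop_unfold[of \<eta>, OF \<eta>]
    by (simp add: oper_mult_add_left trace_add matrix_add_ldistrib E0_adj E1_adj
        trace_superop_adjoint quantum_operationD(1)[OF \<eta>])
qed

text \<open>Fixed-point equation of the loop. With a single \<open>N\<close> the exit branch and the
  remaining loop use the same predicate; for a larger set, \<open>meas_pre\<close> could pick
  different ones.\<close>

lemma meas_pre_wp_While:
  assumes wf: "wf_prog (While qs P0 P1 S)"
  shows "meas_pre qs P0 P1 {N} (wp S (wp (While qs P0 P1 S) {N})) = wp (While qs P0 P1 S) {N}"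
proof -
  let ?E0 = "proj_so qs P0" and ?E1 = "proj_so qs P1"
  let ?loop = "\<lambda>\<eta>. superop_adjoint (loop_so ?E0 ?E1 \<eta>) N"
  interpret quantum_loop ?E0 ?E1
    using wf by (simp add: quantum_loop_proj_so)
  have op: "quantum_operation \<E>" if "\<E> \<in> sem S" for \<E>
    using wf by (intro quantum_operation_sem[OF _ that]) simp
  have unfold: "?loop \<eta> = ?E0 N + ?E1 (superop_adjoint (\<eta> 0) (?loop (\<lambda>k. \<eta> (Suc k))))"
    if "\<forall>i. \<eta> i \<in> sem S" for \<eta>
    using that op by (intro loop_adjoint_unfold) (simp_all add: trace_proj_so_adjoint)
  have wp: "wp (While qs P0 P1 S) {N} = {?loop \<eta> | \<eta>. \<forall>i. \<eta> i \<in> sem S}"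
    unfolding wp_def sem_While by blast
  show ?thesis
  proof (intro equalityI subsetI)
    fix M assume "M \<in> meas_pre qs P0 P1 {N} (wp S (wp (While qs P0 P1 S) {N}))"
    then obtain \<E> \<eta> where M: "M = ?E0 N + ?E1 (superop_adjoint \<E> (?loop \<eta>))"
      and \<eta>: "\<E> \<in> sem S" "\<forall>i. \<eta> i \<in> sem S"
      unfolding meas_pre_def wp wp_def[of S] by blast
    \<comment> \<open>Prepending \<E> to \<eta> gives the scheduler that realizes
      \<open>M\<close>.\<close>
    have "\<forall>i. case_nat \<E> \<eta> i \<in> sem S"
      using \<eta> by (simp split: nat.split)
    moreover from unfold[OF this] have "M = ?loop (case_nat \<E> \<eta>)"
      using M by simp
    ultimately show "M \<in> wp (While qs P0 P1 S) {N}"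
      unfolding wp by blast
  next
    fix M assume "M \<in> wp (While qs P0 P1 S) {N}"
    then obtain \<eta> where M: "M = ?loop \<eta>" and \<eta>: "\<forall>i. \<eta> i \<in> sem S"
      unfolding wp by blast
    then have "?loop (\<lambda>k. \<eta> (Suc k)) \<in> wp (While qs P0 P1 S) {N}"
      unfolding wp by blast
    then have "superop_adjoint (\<eta> 0) (?loop (\<lambda>k. \<eta> (Suc k))) \<in> wp S (wp (While qs P0 P1 S) {N})"
      using \<eta> unfolding wp_def[of S] by blast
    then show "M \<in> meas_pre qs P0 P1 {N} (wp S (wp (While qs P0 P1 S) {N}))"
      unfolding M unfold[OF \<eta>] meas_pre_def by blast
  qed
qed

text \<open>Tail 0 is the whole loop, so its dual lies in \<open>wp\<close>; the dual tails decrease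
  to 0; and moving one round across gives the third condition with equality.\<close>

lemma ranking_assertion_wp_While:
  assumes wf: "wf_prog (While qs P0 P1 S)" and N: "quantum_predicate N"
  shows "\<exists>R. ranking_assertion (wp (While qs P0 P1 S) {N}) qs P1 S R"
proof -
  let ?E0 = "proj_so qs P0" and ?E1 = "proj_so qs P1"
  interpret quantum_loop ?E0 ?E1
    using wf by (simp add: quantum_loop_proj_so)
  define R where "R \<eta> i = superop_adjoint (loop_tail \<eta> i) N" for \<eta> i
  have "ranking_assertion (wp (While qs P0 P1 S) {N}) qs P1 S R"
    unfolding ranking_assertion_def
  proof (intro allI impI)
    fix \<eta> :: "nat \<Rightarrow> 'a superop"
    assume \<eta>: "\<forall>i. \<eta> i \<in> sem S"
    have op: "quantum_operation (\<eta> i)" for i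
      using wf by (intro quantum_operation_sem[OF _ \<eta>[rule_format]]) simp
    have pred: "quantum_predicate (R \<eta> i)" for i
      unfolding R_def by (rule quantum_predicate_adjoint[OF quantum_operation_tail[OF op] N])
    have trace_R: "trace (R \<eta> i ** \<rho>) = trace (N ** loop_tail \<eta> i \<rho>)" for i \<rho>
      unfolding R_def by (rule trace_superop_adjoint[OF quantum_operationD(1)[OF quantum_operation_tail[OF op]]])
    have dagger_R: "dagger (R \<eta> i) = R \<eta> i" for i
      by (rule quantum_predicateD(2)[OF pred])
    have dec: "R \<eta> (Suc i) \<sqsubseteq>\<^sub>L R \<eta> i" for i
      unfolding lowner_le_trace
    proof (intro conjI allI impI)
      show "dagger (R \<eta> i - R \<eta> (Suc i)) = R \<eta> i - R \<eta> (Suc i)"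
        by (simp add: dagger_diff dagger_R)
      fix \<rho> :: "'a oper" assume \<rho>: "psd \<rho>"
      have "0 \<le> Re (trace (N ** ?E0 (loop_iter ?E1 \<eta> i \<rho>)))"
        by (rule quantum_predicateD(3)[OF N quantum_operationD(2)[OF E0 quantum_operationD(2)[OF quantum_operation_iter[OF op] \<rho>]]])
      then show "Re (trace (R \<eta> (Suc i) ** \<rho>)) \<le> Re (trace (R \<eta> i ** \<rho>))"
        unfolding trace_R loop_tail_Suc[of \<eta>, OF op, of i \<rho>] by (simp add: matrix_add_ldistrib trace_add)
    qed
    have meet: "A \<sqsubseteq>\<^sub>L 0" if A: "\<forall>i. A \<sqsubseteq>\<^sub>L R \<eta> i" for A
      unfolding lowner_le_trace
    proof (intro conjI allI impI)
      have "dagger (R \<eta> 0 - A) = R \<eta> 0 - A"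
        using A unfolding lowner_le_trace by blast
      \<comment> \<open>\<open>A\<close> is the difference of the Hermitian operators
        \<open>R \<eta> 0\<close> and \<open>R \<eta> 0 - A\<close>.\<close>
      then have "dagger A = A"
        by (simp add: dagger_diff dagger_R)
      then show "dagger (0 - A) = 0 - A"
        by (simp only: dagger_diff dagger_zero)
      fix \<rho> :: "'a oper" assume \<rho>: "psd \<rho>"
      \<comment> \<open>Every expectation of \<open>A\<close> lies below a sequence tending to
        0.\<close>
      have "Re (trace (A ** \<rho>)) \<le> Re (trace (N ** loop_tail \<eta> i \<rho>))" for i
        using A \<rho> unfolding lowner_le_trace trace_R by blast
      then have "Re (trace (A ** \<rho>)) \<le> 0"
        using LIMSEQ_le_const[OF loop_tail_tendsto_0[of \<eta>, OF op]] by blast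
      then show "Re (trace (A ** \<rho>)) \<le> Re (trace (0 ** \<rho>))"
        by simp
    qed
    have "?E1 (superop_adjoint (\<eta> 0) (R (\<lambda>k. \<eta> (Suc k)) i)) = R \<eta> (Suc i)" for i
    proof (rule trace_dual_unique)
      have "trace (R (\<lambda>k. \<eta> (Suc k)) i ** \<rho>) = trace (N ** loop_tail (\<lambda>k. \<eta> (Suc k)) i \<rho>)" for \<rho>
        unfolding R_def by (rule trace_superop_adjoint[OF quantum_operationD(1)[OF quantum_operation_tail[OF op]]])
      then show "trace (?E1 (superop_adjoint (\<eta> 0) (R (\<lambda>k. \<eta> (Suc k)) i)) ** \<rho>) = trace (R \<eta> (Suc i) ** \<rho>)" for \<rho>
        by (simp add: trace_proj_so_adjoint trace_superop_adjoint[OF quantum_operationD(1)[OF op]] trace_R loop_tail_shift)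
    qed
    moreover have "R \<eta> 0 \<in> wp (While qs P0 P1 S) {N}"
      unfolding R_def loop_tail_0 wp_def sem_While using \<eta> by blast
    then have "le_inf (wp (While qs P0 P1 S) {N}) {R \<eta> 0}"
      by (intro le_inf_superset) simp
    moreover have "A \<sqsubseteq>\<^sub>L A" for A :: "'a oper"
      by (simp add: lowner_le_def)
    moreover have "0 \<sqsubseteq>\<^sub>L R \<eta> i" for i
      using pred by (simp add: quantum_predicate_def)
    ultimately show "(\<forall>i. quantum_predicate (R \<eta> i)) \<and> le_inf (wp (While qs P0 P1 S) {N}) {R \<eta> 0} \<and>
      (\<forall>i. R \<eta> (Suc i) \<sqsubseteq>\<^sub>L R \<eta> i) \<and> (\<forall>i. 0 \<sqsubseteq>\<^sub>L R \<eta> i) \<and> (\<forall>A. (\<forall>i. A \<sqsubseteq>\<^sub>L R \<eta> i) \<longrightarrow> A \<sqsubseteq>\<^sub>L 0) \<and>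
      (\<forall>i. ?E1 (superop_adjoint (\<eta> 0) (R (\<lambda>k. \<eta> (Suc k)) i)) \<sqsubseteq>\<^sub>L R \<eta> (Suc i))"
      using pred dec meet by simp
  qed
  then show ?thesis by blast
qed

text \<open>\<open>N\<close> is arbitrary in the induction because sequencing and loops need the
  hypothesis at predicates other than the given one.\<close>

lemma derivable_wp_singleton:
  "wf_prog S \<Longrightarrow> quantum_predicate N \<Longrightarrow> derivable (wp S {N}) S {N}"
proof (induction S arbitrary: N)
  case Skip
  have "superop_adjoint id N = N"
    by (rule superop_adjointI[OF is_kraus_id]) simp
  then have "wp Skip {N} = {N}"
    by (simp add: wp_def)
  then show ?case
    using derivable.Skip[of "{N}"] Skip.prems by (simp add: assertion_def)
next
  case Abort
  have "superop_adjoint (\<lambda>_. 0) N = 0"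
    by (rule superop_adjointI[OF is_kraus_zero]) simp
  then have wp: "wp Abort {N} = {0}"
    by (simp add: wp_def)
  \<comment> \<open>(AbortT) only offers the postcondition \<open>{0}\<close>; (Imp) weakens it to
    \<open>{N}\<close> by positivity.\<close>
  have "le_inf {0} {N}"
    unfolding le_inf_def Exp_def using Abort.prems
    by (simp add: quantum_predicateD(3) partial_density_def)
  moreover have "assertion {0}" "assertion {N}" "le_inf {0} {0}"
    using Abort.prems by (simp_all add: assertion_def quantum_predicate_zero le_inf_superset)
  ultimately show ?case
    unfolding wp using derivable.Imp derivable.AbortT by blast
next
  case (Init qs)
  then have "wp (Init qs) {N} = init_pre qs ` {N}"
    by (simp add: wp_def init_pre_adjoint)
  then show ?case
    using derivable.Init[of "{N}" qs] Init.prems by (simp add: assertion_def)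
next
  case (Unit qs U)
  then have "wp (Unit qs U) {N} = (\<lambda>M. dagger (lift_op qs U) ** M ** lift_op qs U) ` {N}"
    by (simp add: wp_def unitary_adjoint)
  then show ?case
    using derivable.Unit[of "{N}" qs U] Unit.prems by (simp add: assertion_def)
next
  case (Seq S0 S1)
  then have wf: "wf_prog S0" "wf_prog S1" by simp_all
  have adj: "superop_adjoint (F \<circ> E) N = superop_adjoint E (superop_adjoint F N)"
    if "E \<in> sem S0" "F \<in> sem S1" for E F
  proof (rule superop_adjointI)
    have kraus: "is_kraus E" "is_kraus F"
      using quantum_operationD(1)[OF quantum_operation_sem] wf that by blast+
    then show "is_kraus (F \<circ> E)"
      using is_kraus_comp[OF kraus(2,1)] by (simp add: o_def)
    show "trace (superop_adjoint E (superop_adjoint F N) ** \<rho>) = trace (N ** (F \<circ> E) \<rho>)" for \<rho>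
      by (simp add: trace_superop_adjoint kraus)
  qed
  have "wp (Seq S0 S1) {N} = wp S0 (wp S1 {N})"
  proof -
    have "wp (Seq S0 S1) {N} = {superop_adjoint (F \<circ> E) N | E F. E \<in> sem S0 \<and> F \<in> sem S1}"
      by (auto simp: wp_def)
    also have "\<dots> = {superop_adjoint E (superop_adjoint F N) | E F. E \<in> sem S0 \<and> F \<in> sem S1}"
      by (intro Collect_cong ex_cong1) (use adj in auto)
    also have "\<dots> = wp S0 (wp S1 {N})"
      by (auto simp: wp_def)
    finally show ?thesis .
  qed
  moreover have "assertion (wp S1 {N})"
    using assertion_wp[OF wf(2), of "{N}"] Seq.prems(2) by (simp add: assertion_def)
  \<comment> \<open>The intermediate assertion need not be a singleton, so (Union) recombines the
    derivations for its members.\<close>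
  then have "derivable (wp S0 (wp S1 {N})) S0 (wp S1 {N})"
    by (auto simp: assertion_def intro!: derivable_wp_singletons[of "wp S1 {N}"] Seq.IH(1)[OF wf(1)])
  ultimately show ?case
    using derivable.Seq Seq.IH(2)[OF wf(2) Seq.prems(2)] by metis
next
  case (NDet S0 S1)
  have ass: "assertion {N}" "assertion (wp (NDet S0 S1) {N})"
    using NDet.prems assertion_wp[OF NDet.prems(1), of "{N}"] by (simp_all add: assertion_def)
  \<comment> \<open>Under \<open>le_inf\<close> the larger set is the stronger precondition, so
    (Imp) adapts each branch to the union.\<close>
  have sub: "wp S0 {N} \<subseteq> wp (NDet S0 S1) {N}" "wp S1 {N} \<subseteq> wp (NDet S0 S1) {N}"
    by (auto simp: wp_def)
  have wf: "wf_prog S0" "wf_prog S1"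
    using NDet.prems by simp_all
  have refl: "le_inf {N} {N}"
    by (simp add: le_inf_superset)
  show ?case
    by (rule derivable.NDet;
        rule derivable.Imp[OF ass(2,1) le_inf_superset[OF sub(1)] NDet.IH(1)[OF wf(1) NDet.prems(2)] refl]
          derivable.Imp[OF ass(2,1) le_inf_superset[OF sub(2)] NDet.IH(2)[OF wf(2) NDet.prems(2)] refl])
next
  case (Cond qs P0 P1 S1 S0)
  then have meas: "distinct qs" "reg_proj_meas (length qs) P0 P1" and wf: "wf_prog S0" "wf_prog S1"
    by simp_all
  note P = proj_so_measurement[OF meas]
  have adj: "superop_adjoint (\<lambda>\<rho>. E0 (proj_so qs P0 \<rho>) + E1 (proj_so qs P1 \<rho>)) N =
    proj_so qs P0 (superop_adjoint E0 N) + proj_so qs P1 (superop_adjoint E1 N)"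
    if "E0 \<in> sem S0" "E1 \<in> sem S1" for E0 E1
  proof (rule superop_adjointI)
    have kraus: "is_kraus E0" "is_kraus E1"
      using quantum_operationD(1)[OF quantum_operation_sem] wf that by blast+
    show "is_kraus (\<lambda>\<rho>. E0 (proj_so qs P0 \<rho>) + E1 (proj_so qs P1 \<rho>))"
      by (rule is_kraus_add[OF is_kraus_comp[OF kraus(1) quantum_operationD(1)[OF P(1)]]
            is_kraus_comp[OF kraus(2) quantum_operationD(1)[OF P(2)]]])
    show "trace ((proj_so qs P0 (superop_adjoint E0 N) + proj_so qs P1 (superop_adjoint E1 N)) ** \<rho>) =
      trace (N ** (E0 (proj_so qs P0 \<rho>) + E1 (proj_so qs P1 \<rho>)))" for \<rho>
      by (simp add: oper_mult_add_left matrix_add_ldistrib trace_add trace_proj_so_adjoint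
          trace_superop_adjoint kraus)
  qed
  \<comment> \<open>Exact because both branches refer to the same \<open>N\<close>.\<close>
  have "wp (Cond qs P0 P1 S1 S0) {N} = meas_pre qs P0 P1 (wp S0 {N}) (wp S1 {N})"
  proof -
    have "wp (Cond qs P0 P1 S1 S0) {N} =
      {superop_adjoint (\<lambda>\<rho>. E0 (proj_so qs P0 \<rho>) + E1 (proj_so qs P1 \<rho>)) N | E0 E1. E0 \<in> sem S0 \<and> E1 \<in> sem S1}"
      by (auto simp: wp_def)
    also have "\<dots> = {proj_so qs P0 (superop_adjoint E0 N) + proj_so qs P1 (superop_adjoint E1 N) | E0 E1.
      E0 \<in> sem S0 \<and> E1 \<in> sem S1}"
      by (intro Collect_cong ex_cong1) (use adj in auto)
    also have "\<dots> = meas_pre qs P0 P1 (wp S0 {N}) (wp S1 {N})"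
      by (auto simp: wp_def meas_pre_def)
    finally show ?thesis .
  qed
  then show ?case
    using derivable.Meas[OF Cond.IH(1)[OF wf(2) Cond.prems(2)] Cond.IH(2)[OF wf(1) Cond.prems(2)]] by simp
next
  case (While qs P0 P1 S)
  let ?W = "wp (While qs P0 P1 S) {N}"
  have wf: "wf_prog S"
    using While.prems by simp
  have "assertion ?W"
    using assertion_wp[OF While.prems(1), of "{N}"] While.prems(2) by (simp add: assertion_def)
  then have "derivable (wp S ?W) S ?W"
    by (auto simp: assertion_def intro!: derivable_wp_singletons[of ?W] While.IH[OF wf])
  then show ?case
    \<comment> \<open>The assertion \<Theta> of (WhileT) is \<open>wp S ?W\<close>; by the
      fixed-point equation the invariant is then \<open>?W\<close> itself.\<close>
    using derivable.WhileT[of "{N}" "wp S ?W" S qs P0 P1] ranking_assertion_wp_While[OF While.prems] While.prems(2)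
    by (simp add: meas_pre_wp_While[OF While.prems(1)] assertion_def del: wf_prog.simps)
qed

theorem theorem4p8:
  fixes S :: "'q::finite prog" and \<Theta> \<Psi> :: "'q oper set"
  assumes "wf_prog S" and "assertion \<Theta>" and "assertion \<Psi>"
  shows "derivable \<Theta> S \<Psi> \<longleftrightarrow> valid_tot \<Theta> S \<Psi>"
proof
  assume "derivable \<Theta> S \<Psi>"
  then show "valid_tot \<Theta> S \<Psi>"
    using derivable_sound assms(1) by blast
next
  assume "valid_tot \<Theta> S \<Psi>"
  then have "le_inf \<Theta> (wp S \<Psi>)"
    by (simp add: valid_tot_iff_wp assms(1))
  moreover have "derivable (wp S \<Psi>) S \<Psi>"
    by (rule derivable_wp_singletons, rule derivable_wp_singleton) (use assms in \<open>simp_all add: assertion_def\<close>)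
  moreover have "le_inf \<Psi> \<Psi>"
    by (simp add: le_inf_superset)
  ultimately show "derivable \<Theta> S \<Psi>"
    by (rule derivable.Imp[OF assms(2,3)])
qed

end
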